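(* Suppose that $$\mathbb{E}\log|M|\in(-\infty,0)\quad\text{and}\quad\mathbb{E}\log^+|Q|<\infty.$$ Then $$\mathbb{E}\,b(\log^+|Z_\infty|)<\infty\quad\Longleftrightarrow\quad \mathbb{E}\,c(\log^+|M|)<\infty\ \text{ and }\ \mathbb{E}\,c(\log^+|Q|)<\infty.$$
   Context: $(M_1,Q_1),(M_2,Q_2),\dots$ are independent copies of a random vector $(M,Q)$ with values in $\mathbb{R}^2$, defined on a fixed probability space. Put $\Pi_0:=1$, $\Pi_n:=M_1M_2\cdots M_n$ for $n\ge1$, and $Z_\infty:=\sum_{k=1}^\infty\Pi_{k-1}Q_k$. (Under the condition $\mathbb{E}\log|M|\in(-\infty,0)$, $\mathbb{E}\log^+|Q|<\infty$ this series converges absolutely almost surely.) Standing assumptions: $\mathbb{P}\{M=0\}=0$, $\mathbb{P}\{Q=0\}<1$, and, provided the series defining $Z_\infty$ is absolutely convergent, the distribution of $Z_\infty$ is non-degenerate (i.e. $Z_\infty$ is not almost surely constant). $b:\mathbb{R}^+\to\mathbb{R}^+$ is a function regularly varying at $\infty$ with exponent $\beta>0$, and $c(x):=x\,b(x)$. Here $\log^+x=\max(\log x,0)$ (and $\log^+0=0$).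
   Formalization: The function b is additionally assumed bounded on every interval [0,a]; without this the equivalence fails, e.g. for M=1/2, Q=±1 with equal probability and b having a non-integrable singularity at (log 2)/2. *)

theory Defs
  imports "HOL-Probability.Probability"
begin

definition log_plus :: "real \<Rightarrow> real" where
  "log_plus x = (if x \<le> 0 then 0 else max (ln x) 0)"

(* Only the values of b on [0,\<infinity>) are relevant.  As is standard, measurability is part of
   regular variation.  Since x / 0 = 0 in HOL, the limit for t = 1 forces b x \<noteq> 0 for all
   large x, so the quotients are eventually genuine. *)
definition regularly_varying_at_top :: "(real \<Rightarrow> real) \<Rightarrow> real \<Rightarrow> bool" where
  "regularly_varying_at_top b \<beta> \<longleftrightarrow>
     b \<in> borel_measurable (restrict_space borel {0..}) \<and>
     (\<forall>t>0. ((\<lambda>x. b (t * x) / b x) \<longlongrightarrow> t powr \<beta>) at_top)"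

(* A sequence represents (M_k, Q_k), k \<ge> 1; the entry at index 0 is never used. *)

definition discount :: "(nat \<Rightarrow> 'a \<Rightarrow> real) \<Rightarrow> nat \<Rightarrow> 'a \<Rightarrow> real" where
  "discount M n \<omega> = (\<Prod>k=1..n. M k \<omega>)"

(* The summation index is shifted by one: term k is Pi_k Q_(k+1).  Where the series diverges
   the value is arbitrary. *)
definition perpetuity :: "(nat \<Rightarrow> 'a \<Rightarrow> real) \<Rightarrow> (nat \<Rightarrow> 'a \<Rightarrow> real) \<Rightarrow> 'a \<Rightarrow> real" where
  "perpetuity M Q \<omega> = (\<Sum>k. discount M k \<omega> * Q (Suc k) \<omega>)"

definition perpetuity_abs_conv ::
  "(nat \<Rightarrow> 'a \<Rightarrow> real) \<Rightarrow> (nat \<Rightarrow> 'a \<Rightarrow> real) \<Rightarrow> 'a \<Rightarrow> bool" where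
  "perpetuity_abs_conv M Q \<omega> \<longleftrightarrow> summable (\<lambda>k. \<bar>discount M k \<omega> * Q (Suc k) \<omega>\<bar>)"

end

(*
  Regular variation enters only through a monotone function B of moderate growth with b comparable
  to B; everything is then an argument on the space of i.i.d. sequences of pairs (M_k, Q_k), with
  walk S_n = log |Pi_n| and eta_n = max (log+ |M_n|) (log+ |Q_n|).

  Sufficiency: log+ |Z| is at most a constant plus sup_n (S_n + 2an) plus sup_n (log+ |Q_n| - an).  The
  first supremum has a finite B-moment because the primitive of B is a Lyapunov function for the walk
  reflected at 0, the second one by counting the n with an < log+ |Q_n|.

  Necessity: since Z is non-degenerate, a first-passage argument for the partial sums W_n and the
  products Pi_n in Z = W_n + Pi_n Z' bounds P(sup_n max (|W_n|, |Pi_n|) > y) by a constant times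
  P(|Z| > kappa y).  The supremum exceeds y as soon as S_n + eta_n > log (2y) for some n, and S_n stays
  above a line -An with probability at least 1/2, so that sum_n P(eta > x + An), that is E (eta - x)^+,
  is at most a constant times P(log+ |Z| > x - const).  Summing against the increments of B gives
  E eta B(eta) < infinity.
*)
theory Submission
  imports Defs
begin

subsection \<open>Regular variation\<close>

text \<open>The extra factor x in c counts times: against a line of slope -A, a jump of size eta can
  lift the walk over a level x at about (eta - x) / A different times. In the necessity part this
  count is a lower bound; in the sufficiency part it is the upper bound for the supremum with Q,
  while the supremum with M meets the same factor by integrating B. The obstacle to necessity is
  cancellation: the summands carry signs, so one huge summand does not make Z huge on the same path.
  It does so with conditional probability bounded below, because Z' is independent of (W_n, Pi_n),
  and an affine image u + v Z' of one fixed non-degenerate variable cannot concentrate near 0 when u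
  or v is large. The obstacle to sufficiency is that only a finite mean is known of the negative
  part of log |M|. The Lyapunov estimate therefore truncates downward jumps at a level L, chosen so
  large that the truncated mean is still negative.\<close>

lemma emeasure_lborel_shift:
  assumes "A \<in> sets borel"
  shows "emeasure lborel {x::real. x - u \<in> A} = emeasure lborel A"
proof -
  have "emeasure lborel A = emeasure (distr lborel borel ((+) (-u))) A"
    by (simp add: lborel_distr_plus)
  also have "\<dots> = emeasure lborel ((+) (-u) -` A)"
    using assms by (subst emeasure_distr) auto
  also have "(+) (-u) -` A = {x. x - u \<in> A}"
    by auto
  finally show ?thesis ..
qed

text \<open>For each fixed v in [0,3] the increment tends to a number in [0, 3\<beta>], so the sets
  \<open>A n\<close> increase to the whole interval and continuity from below applies. The threshold
  5/2 is chosen so that two such sets inside an interval of length 4 must overlap.\<close>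

lemma emeasure_near_full_increments:
  fixes h :: "real \<Rightarrow> real" and s :: "nat \<Rightarrow> real"
  assumes [measurable]: "h \<in> borel_measurable borel"
    and lim: "\<And>u. ((\<lambda>s. h (s + u) - h s) \<longlongrightarrow> \<beta> * u) at_top"
    and s: "filterlim s at_top sequentially"
    and beta: "\<beta> > 0"
  defines "A \<equiv> \<lambda>n. {v\<in>{0..3}. \<forall>m\<ge>n. \<bar>h (s m + v) - h (s m)\<bar> \<le> 3 * \<beta> + 1}"
  shows "A n \<in> sets borel" "eventually (\<lambda>n. emeasure lborel (A n) > ennreal (5/2)) sequentially"
proof -
  have Am [measurable]: "A n \<in> sets borel" for n
    unfolding A_def by measurable
  then show "A n \<in> sets borel" .
  have "v \<in> (\<Union>n. A n)" if v: "v \<in> {0..3}" for v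
  proof -
    have "((\<lambda>n. h (s n + v) - h (s n)) \<longlongrightarrow> \<beta> * v) sequentially"
      using filterlim_compose[OF lim s] by simp
    then have "eventually (\<lambda>n. dist (h (s n + v) - h (s n)) (\<beta> * v) < 1) sequentially"
      by (rule tendstoD) simp
    then obtain N where N: "\<And>n. n \<ge> N \<Longrightarrow> dist (h (s n + v) - h (s n)) (\<beta> * v) < 1"
      by (auto simp: eventually_sequentially)
    have "\<beta> * v \<le> \<beta> * 3" "0 \<le> \<beta> * v"
      using v beta by (auto intro: mult_left_mono)
    then have "\<bar>h (s n + v) - h (s n)\<bar> \<le> 3 * \<beta> + 1" if "n \<ge> N" for n
      using N[OF that] by (auto simp: dist_real_def)
    then show ?thesis
      using v unfolding A_def by blast
  qed
  then have U: "(\<Union>n. A n) = {0..3}"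
    unfolding A_def by blast
  have "(\<lambda>n. emeasure lborel (A n)) \<longlonglongrightarrow> emeasure lborel (\<Union>n. A n)"
    by (rule Lim_emeasure_incseq) (auto simp: incseq_def A_def)
  then have "(\<lambda>n. emeasure lborel (A n)) \<longlonglongrightarrow> ennreal 3"
    unfolding U by simp
  then show "eventually (\<lambda>n. emeasure lborel (A n) > ennreal (5/2)) sequentially"
    by (rule order_tendstoD) (simp add: ennreal_less_iff del: ennreal_numeral)
qed

text \<open>The two sets of good increments, based at \<open>s n\<close> and at \<open>s n + u n\<close>, both nearly fill
  an interval of length 3 inside \<open>{0..4}\<close> and hence meet.\<close>

lemma additive_limit_locally_bounded:
  fixes h :: "real \<Rightarrow> real"
  assumes hm [measurable]: "h \<in> borel_measurable borel"
    and lim: "\<And>u. ((\<lambda>s. h (s + u) - h s) \<longlongrightarrow> \<beta> * u) at_top"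
    and beta: "\<beta> > 0"
  shows "\<exists>s0. \<forall>s\<ge>s0. \<forall>u\<in>{0..1}. \<bar>h (s + u) - h s\<bar> \<le> 6 * \<beta> + 2"
proof (rule ccontr)
  assume "\<not> ?thesis"
  then have "\<forall>n. \<exists>s u. s \<ge> real n \<and> u \<in> {0..1} \<and> \<bar>h (s + u) - h s\<bar> > 6 * \<beta> + 2"
    by (meson not_le)
  then obtain s u where su: "\<And>n. s n \<ge> real n" "\<And>n. u n \<in> {0..1}"
      "\<And>n. \<bar>h (s n + u n) - h (s n)\<bar> > 6 * \<beta> + 2"
    by metis
  define t where "t n = s n + u n" for n
  have s: "filterlim s at_top sequentially"
    by (rule filterlim_at_top_mono[OF filterlim_real_sequentially]) (simp add: su)
  have t: "filterlim t at_top sequentially"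
    by (rule filterlim_at_top_mono[OF s]) (use su(2) in \<open>simp add: t_def\<close>)
  define A where "A s n = {v\<in>{0..3}. \<forall>m\<ge>n. \<bar>h (s m + v) - h (s m)\<bar> \<le> 3 * \<beta> + 1}"
    for s :: "nat \<Rightarrow> real" and n :: nat
  note inc = emeasure_near_full_increments[OF hm lim _ beta, folded A_def]
  obtain n where n: "emeasure lborel (A s n) > ennreal (5/2)" "emeasure lborel (A t n) > ennreal (5/2)"
    using eventually_conj[OF inc(2)[OF s] inc(2)[OF t]]
    by (auto simp: eventually_sequentially)
  define A' where "A' = {x. x - u n \<in> A t n}"
  have [measurable]: "A s n \<in> sets borel" "A t n \<in> sets borel"
    using inc(1)[OF s] inc(1)[OF t] by auto
  have [measurable]: "A' \<in> sets borel"
    unfolding A'_def by measurable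
  have "A s n \<inter> A' \<noteq> {}"
  proof
    assume disj: "A s n \<inter> A' = {}"
    have "A s n \<union> A' \<subseteq> {0..4}"
      using su(2)[of n] by (auto simp: A_def A'_def)
    then have "emeasure lborel (A s n \<union> A') \<le> emeasure lborel {0..4::real}"
      by (intro emeasure_mono) auto
    also have "emeasure lborel (A s n \<union> A') = emeasure lborel (A s n) + emeasure lborel A'"
      using disj by (subst plus_emeasure) auto
    also have "emeasure lborel A' = emeasure lborel (A t n)"
      unfolding A'_def by (rule emeasure_lborel_shift) simp
    finally have "emeasure lborel (A s n) + emeasure lborel (A t n) \<le> ennreal 4"
      by simp
    moreover have "ennreal (5/2) + ennreal (5/2) \<le> emeasure lborel (A s n) + emeasure lborel (A t n)"
      using n by (intro add_mono) auto
    ultimately have "ennreal (5/2) + ennreal (5/2) \<le> ennreal 4"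
      by (rule order_trans[rotated])
    then show False
      by (simp add: ennreal_plus[symmetric] del: ennreal_plus ennreal_numeral)
  qed
  then obtain v where v: "v \<in> A s n" "v - u n \<in> A t n"
    unfolding A'_def by auto
  \<comment> \<open>The point s n + v is the same as t n + (v - u n). Comparing both base points
    with it costs 3\<beta> + 1 each, whence the bound 6\<beta> + 2.\<close>
  have "\<bar>h (s n + v) - h (s n)\<bar> \<le> 3 * \<beta> + 1"
    using v(1) by (auto simp: A_def)
  moreover have "\<bar>h (t n + (v - u n)) - h (t n)\<bar> \<le> 3 * \<beta> + 1"
    using v(2) unfolding A_def by blast
  ultimately show False
    using su(3)[of n] by (simp add: t_def)
qed

text \<open>Far out, every unit increment lies within \<beta> of its limit \<beta>, hence in (0,
  2\<beta>). Chaining unit steps covers the integer part of t, and the local bound covers the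
  fractional part.\<close>

lemma additive_limit_linear_bounds:
  fixes h :: "real \<Rightarrow> real"
  assumes hm [measurable]: "h \<in> borel_measurable borel"
    and lim: "\<And>u. ((\<lambda>s. h (s + u) - h s) \<longlongrightarrow> \<beta> * u) at_top"
    and beta: "\<beta> > 0"
  shows "\<exists>s0. \<forall>s\<ge>s0. \<forall>t\<ge>0. - (6 * \<beta> + 2) \<le> h (s + t) - h s \<and> h (s + t) - h s \<le> 2 * \<beta> * t + (6 * \<beta> + 2)"
proof -
  obtain s1 where s1: "\<And>s u. s \<ge> s1 \<Longrightarrow> 0 \<le> u \<Longrightarrow> u \<le> 1 \<Longrightarrow> \<bar>h (s + u) - h s\<bar> \<le> 6 * \<beta> + 2"
    using additive_limit_locally_bounded[OF assms] by (metis atLeastAtMost_iff)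
  have "eventually (\<lambda>s. dist (h (s + 1) - h s) (\<beta> * 1) < \<beta>) at_top"
    by (rule tendstoD[OF lim]) (rule beta)
  then obtain s2 where s2: "\<And>s. s \<ge> s2 \<Longrightarrow> dist (h (s + 1) - h s) \<beta> < \<beta>"
    by (auto simp: eventually_at_top_linorder)
  have step: "0 \<le> h (s + real n) - h s \<and> h (s + real n) - h s \<le> 2 * \<beta> * real n"
    if "s \<ge> s2" for s n
  proof (induction n)
    case (Suc n)
    have "dist (h (s + real n + 1) - h (s + real n)) \<beta> < \<beta>"
      using that by (intro s2) simp
    then show ?case
      using Suc by (auto simp: dist_real_def algebra_simps)
  qed simp
  show ?thesis
  proof (intro exI[of _ "max s1 s2"] allI impI)
    fix s t :: real
    assume s: "s \<ge> max s1 s2" and t: "t \<ge> 0"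
    define n where "n = nat \<lfloor>t\<rfloor>"
    define u where "u = t - real n"
    have u: "0 \<le> u" "u \<le> 1" and n: "real n \<le> t"
      using t unfolding u_def n_def by linarith+
    have "\<bar>h (s + real n + u) - h (s + real n)\<bar> \<le> 6 * \<beta> + 2"
      using s u by (intro s1) auto
    moreover have "0 \<le> h (s + real n) - h s \<and> h (s + real n) - h s \<le> 2 * \<beta> * real n"
      using s by (intro step) auto
    moreover have "2 * \<beta> * real n \<le> 2 * \<beta> * t"
      using n beta by simp
    moreover have "s + real n + u = s + t"
      by (simp add: u_def)
    ultimately show "- (6 * \<beta> + 2) \<le> h (s + t) - h s \<and> h (s + t) - h s \<le> 2 * \<beta> * t + (6 * \<beta> + 2)"
      by auto
  qed
qed

lemma regularly_varying_eventually_pos: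
  assumes "regularly_varying_at_top b \<beta>" and nn: "\<And>x. x \<ge> 0 \<Longrightarrow> b x \<ge> 0"
  shows "\<exists>x0>0. \<forall>x\<ge>x0. b x > 0"
proof -
  have "((\<lambda>x. b (1 * x) / b x) \<longlongrightarrow> 1 powr \<beta>) at_top"
    using assms(1) zero_less_one unfolding regularly_varying_at_top_def by blast
  then have "eventually (\<lambda>x. b x / b x > 0) at_top"
    by (intro order_tendstoD(1)) auto
  then have "eventually (\<lambda>x. x > 0 \<and> b x \<noteq> 0) at_top"
    using eventually_gt_at_top[of 0] by eventually_elim auto
  then obtain x0 where x0: "\<And>x. x \<ge> x0 \<Longrightarrow> x > 0 \<and> b x \<noteq> 0"
    by (auto simp: eventually_at_top_linorder)
  show ?thesis
    using x0 nn by (intro exI[of _ x0]) (auto simp: less_le)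
qed

text \<open>A coarse form of Potter's bounds: the additive estimates for
  \<open>h s = ln (b (exp s))\<close>, exponentiated. The exponents 0 and n with n \<ge> 2\<beta>
  stand in for \<beta> - \<epsilon> and \<beta> + \<epsilon>, at the price of the constant C = exp
  (6\<beta> + 2).\<close>

lemma regularly_varying_power_bounds:
  assumes rv: "regularly_varying_at_top b \<beta>" and nn: "\<And>x. x \<ge> 0 \<Longrightarrow> b x \<ge> 0" and beta: "\<beta> > 0"
  obtains x1 C n where "x1 > 0" "C > 0" "\<And>x. x \<ge> x1 \<Longrightarrow> b x > 0"
    "\<And>x y. x1 \<le> x \<Longrightarrow> x \<le> y \<Longrightarrow> b x \<le> C * b y"
    "\<And>x y. x1 \<le> x \<Longrightarrow> x \<le> y \<Longrightarrow> b y \<le> C * (y / x) ^ n * b x"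
proof -
  obtain x0 where x0: "x0 > 0" "\<And>x. x \<ge> x0 \<Longrightarrow> b x > 0"
    using regularly_varying_eventually_pos[OF rv nn] by auto
  define h where "h s = ln (b (exp s))" for s
  have "(\<lambda>s. b (exp s)) \<in> borel_measurable borel"
  proof -
    have e: "exp \<in> borel \<rightarrow>\<^sub>M restrict_space borel {0::real..}"
      by (intro measurable_restrict_space2) auto
    have "b \<in> borel_measurable (restrict_space borel {0..})"
      using rv by (auto simp: regularly_varying_at_top_def)
    from measurable_compose[OF e this] show ?thesis .
  qed
  then have hm: "h \<in> borel_measurable borel"
    unfolding h_def by measurable
  have lim: "((\<lambda>s. h (s + u) - h s) \<longlongrightarrow> \<beta> * u) at_top" for u
  proof -
    have "((\<lambda>x. b (exp u * x) / b x) \<longlongrightarrow> exp u powr \<beta>) at_top"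
      using rv by (auto simp: regularly_varying_at_top_def)
    then have "((\<lambda>s. b (exp u * exp s) / b (exp s)) \<longlongrightarrow> exp u powr \<beta>) at_top"
      by (rule filterlim_compose) (rule exp_at_top)
    then have "((\<lambda>s. ln (b (exp u * exp s) / b (exp s))) \<longlongrightarrow> ln (exp u powr \<beta>)) at_top"
      by (rule tendsto_ln) simp
    moreover have "eventually (\<lambda>s. ln (b (exp u * exp s) / b (exp s)) = h (s + u) - h s) at_top"
      using eventually_ge_at_top[of "ln x0"] eventually_ge_at_top[of "ln x0 - u"]
    proof eventually_elim
      case (elim s)
      have "x0 \<le> exp s" "x0 \<le> exp (s + u)"
        using elim x0(1) by (auto simp: ln_ge_iff[symmetric] ln_le_cancel_iff[symmetric]
            simp del: ln_le_cancel_iff)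
      then have "b (exp s) > 0" "b (exp (s + u)) > 0"
        using x0(2) by auto
      then show ?case
        by (simp add: h_def ln_div exp_add mult.commute)
    qed
    ultimately show ?thesis
      using filterlim_cong by (fastforce simp: ln_powr)
  qed
  obtain s0 where s0: "\<And>s t. s \<ge> s0 \<Longrightarrow> t \<ge> 0 \<Longrightarrow> - (6 * \<beta> + 2) \<le> h (s + t) - h s"
      "\<And>s t. s \<ge> s0 \<Longrightarrow> t \<ge> 0 \<Longrightarrow> h (s + t) - h s \<le> 2 * \<beta> * t + (6 * \<beta> + 2)"
    using additive_limit_linear_bounds[OF hm lim beta] by auto
  obtain n :: nat where n: "2 * \<beta> \<le> real n"
    using real_arch_simple by blast
  define x1 where "x1 = max x0 (exp s0)"
  define C where "C = exp (6 * \<beta> + 2)"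
  have x1: "x1 > 0" "\<And>x. x \<ge> x1 \<Longrightarrow> b x > 0"
    using x0 by (auto simp: x1_def)
  have 12: "b x \<le> C * b y" "b y \<le> C * (y / x) ^ n * b x" if xy: "x1 \<le> x" "x \<le> y" for x y
  proof -
    have pos: "x > 0" "y > 0" "b x > 0" "b y > 0"
      using xy x1 by auto
    define s where "s = ln x"
    define t where "t = ln y - ln x"
    have s: "s \<ge> s0"
      using xy pos unfolding s_def x1_def by (simp add: ln_ge_iff)
    have t: "t \<ge> 0"
      using xy pos unfolding t_def by simp
    have hh: "h s = ln (b x)" "h (s + t) = ln (b y)"
      using pos by (auto simp: h_def s_def t_def)
    have "ln (b x) \<le> (6 * \<beta> + 2) + ln (b y)"
      using s0(1)[OF s t] by (simp add: hh)
    then have "exp (ln (b x)) \<le> exp ((6 * \<beta> + 2) + ln (b y))"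
      by simp
    then show "b x \<le> C * b y"
      using pos by (simp add: C_def exp_add)
    have "2 * \<beta> * t \<le> real n * t"
      using n t by (intro mult_right_mono) auto
    then have "ln (b y) \<le> (6 * \<beta> + 2) + real n * t + ln (b x)"
      using s0(2)[OF s t] by (simp add: hh)
    then have "exp (ln (b y)) \<le> exp ((6 * \<beta> + 2) + real n * t + ln (b x))"
      by simp
    also have "\<dots> = C * exp t ^ n * b x"
      using pos by (simp add: C_def exp_add exp_of_nat_mult)
    also have "exp t = y / x"
      using pos by (simp add: t_def exp_diff)
    finally show "b y \<le> C * (y / x) ^ n * b x"
      using pos by simp
  qed
  show ?thesis
    by (rule that[of x1 C n]) (use x1 12 in \<open>auto simp: C_def\<close>)
qed

text \<open>The functions live on the whole line because they are evaluated at negative positions of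
  the walk. There \<open>growth\<close> is consistent with monotonicity: for x < 0 and t \<ge> 1,
  already t x \<le> x.\<close>

locale moderate_growth =
  fixes B :: "real \<Rightarrow> real" and p :: nat
  assumes mono: "mono B"
    and pos: "\<And>x. B x > 0"
    and growth: "\<And>t x. t \<ge> 1 \<Longrightarrow> B (t * x) \<le> t ^ p * B x"

text \<open>For fixed y, \<open>f x y\<close> increases in x and gains at most a factor t ^ n when x
  is multiplied by t; both properties pass to the infimum over y. Taking y = x shows that B is at
  most b beyond \<open>x1\<close>, and the two power bounds, for y \<ge> x and for y < x, show that
  B is at least b / C. On [0, \<open>x1\<close>] B is constant while b is merely bounded, which
  explains the additive constant.\<close>

lemma regularly_varying_moderate_growth:
  assumes rv: "regularly_varying_at_top b \<beta>" and nn: "\<And>x. x \<ge> 0 \<Longrightarrow> b x \<ge> 0" and beta: "\<beta> > 0"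
    and bdd: "\<And>a. bounded (b ` {0..a})"
  obtains B p C where "moderate_growth B p" "C \<ge> 0"
    "\<And>x. x \<ge> 0 \<Longrightarrow> B x \<le> b x + C" "\<And>x. x \<ge> 0 \<Longrightarrow> b x \<le> C * B x"
proof -
  obtain x1 C n where x1: "x1 > 0" and C: "C > 0" and bpos: "\<And>x. x \<ge> x1 \<Longrightarrow> b x > 0"
    and up: "\<And>x y. x1 \<le> x \<Longrightarrow> x \<le> y \<Longrightarrow> b x \<le> C * b y"
    and pot: "\<And>x y. x1 \<le> x \<Longrightarrow> x \<le> y \<Longrightarrow> b y \<le> C * (y / x) ^ n * b x"
    using regularly_varying_power_bounds[OF rv nn beta] by metis
  define f where "f x y = b y * max 1 (x / y) ^ n" for x y
  define B where "B x = (INF y\<in>{x1..}. f x y)" for x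
  have f_ge: "b x / C \<le> f x' y" if "x \<ge> x1" "y \<ge> x1" "x \<le> x'" for x x' y
  proof (cases "x \<le> y")
    case True
    have "b x / C \<le> b y"
      using up[OF that(1) True] C by (simp add: field_simps)
    also have "\<dots> \<le> f x' y"
      using bpos[OF that(2)] unfolding f_def by (simp add: mult_le_cancel_left1)
    finally show ?thesis .
  next
    case False
    have y: "y > 0"
      using x1 that by simp
    have "b x \<le> C * (x / y) ^ n * b y"
      using pot[of y x] False that by auto
    then have "b x / C \<le> b y * (x / y) ^ n"
      using C by (simp add: field_simps)
    also have "\<dots> \<le> f x' y"
      unfolding f_def using bpos[OF that(2)] that x1 y
      by (intro mult_left_mono power_mono) (auto simp: max_def divide_right_mono field_simps)
    finally show ?thesis .
  qed
  have f_pos: "f x y > 0" if "y \<ge> x1" for x y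
    unfolding f_def using bpos[OF that] by (auto simp: zero_less_mult_iff intro!: zero_less_power)
  then have bb: "bdd_below (f x ` {x1..})" for x
    by (intro bdd_belowI[of _ 0]) (auto intro: less_imp_le)
  have f_mono: "f x y \<le> f x' y" if "x \<le> x'" "y \<ge> x1" for x x' y
    unfolding f_def using bpos[OF that(2)] that x1
    by (intro mult_left_mono power_mono max.mono divide_right_mono) auto
  have mono: "mono B"
    unfolding B_def mono_def using f_mono bb by (intro allI impI cINF_mono) auto
  have B_ge: "b x / C \<le> B x" if "x \<ge> x1" for x
    unfolding B_def using that f_ge by (intro cINF_greatest) auto
  have B_le: "B x \<le> f x y" if "y \<ge> x1" for x y
    unfolding B_def using that bb by (intro cINF_lower) auto
  have low: "B x = B x1" if "x \<le> x1" for x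
  proof -
    have "f x y = f x1 y" if y: "y \<in> {x1..}" for y
    proof -
      have "x / y \<le> 1" "x1 / y \<le> 1"
        using y x1 \<open>x \<le> x1\<close> by auto
      then show ?thesis
        by (simp add: f_def max_def)
    qed
    then show ?thesis
      unfolding B_def by (intro INF_cong) auto
  qed
  have B1: "B x1 > 0"
    using B_ge[of x1] bpos[of x1] C by (smt (verit) divide_pos_pos)
  have Bpos: "B x > 0" for x
  proof (cases "x \<le> x1")
    case True
    then show ?thesis using low[OF True] B1 by simp
  next
    case False
    then show ?thesis using B1 monoD[OF mono, of x1 x] by simp
  qed
  have growth: "B (t * x) \<le> t ^ n * B x" if t: "t \<ge> 1" for t x
  proof -
    have "B (t * x) / t ^ n \<le> f x y" if y: "y \<ge> x1" for y
    proof -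
      have "max 1 (t * x / y) \<le> t * max 1 (x / y)"
        using t mult_mono[of 1 t 1 "max 1 (x / y)"] mult_left_mono[of "x / y" "max 1 (x / y)" t]
        by simp
      then have "max 1 (t * x / y) ^ n \<le> t ^ n * max 1 (x / y) ^ n"
        by (metis max.cobounded1 order_trans power_mono power_mult_distrib zero_le_one)
      then have "f (t * x) y \<le> t ^ n * f x y"
        unfolding f_def using bpos[OF y] by (simp add: mult.left_commute mult_left_mono)
      then show ?thesis
        using B_le[OF y, of "t * x"] t by (simp add: field_simps)
    qed
    then have "B (t * x) / t ^ n \<le> B x"
      unfolding B_def[of x] by (intro cINF_greatest) auto
    then show ?thesis
      using t by (simp add: field_simps)
  qed
  obtain K where K: "\<And>x. x \<in> {0..x1} \<Longrightarrow> \<bar>b x\<bar> \<le> K"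
    using bdd[of x1] unfolding bounded_iff real_norm_def by (metis imageI)
  \<comment> \<open>The three entries serve, in order: the additive bound on [0, \<open>x1\<close>],
    the multiplicative bound beyond \<open>x1\<close>, and the multiplicative bound on
    [0, \<open>x1\<close>].\<close>
  define C' where "C' = max (B x1) (max C (K / B x1))"
  show ?thesis
  proof (rule that[of B n C'])
    show "moderate_growth B n"
      by unfold_locales (use mono Bpos growth in auto)
    show "C' \<ge> 0"
      using B1 by (auto simp: C'_def)
    fix x :: real assume x: "x \<ge> 0"
    show "B x \<le> b x + C'"
    proof (cases "x \<le> x1")
      case True
      then show ?thesis using low[OF True] nn[OF x] by (simp add: C'_def)
    next
      case False
      then have "B x \<le> f x x" by (intro B_le) simp
      also have "f x x = b x" using False x1 by (simp add: f_def)
      finally show ?thesis using \<open>C' \<ge> 0\<close> by simp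
    qed
    show "b x \<le> C' * B x"
    proof (cases "x \<le> x1")
      case True
      have "b x \<le> K" using K[of x] True x by auto
      also have "K = (K / B x1) * B x1" using B1 by simp
      also have "\<dots> \<le> C' * B x1" using B1 by (intro mult_right_mono) (auto simp: C'_def)
      finally show ?thesis using low[OF True] by simp
    next
      case False
      then have "b x \<le> C * B x" using B_ge[of x] C by (simp add: field_simps)
      also have "\<dots> \<le> C' * B x" using Bpos[of x] by (intro mult_right_mono) (auto simp: C'_def)
      finally show ?thesis .
    qed
  qed
qed

context moderate_growth
begin

lemma measurable_B [measurable]: "B \<in> borel_measurable borel"
  by (rule borel_measurable_mono) (rule mono)

lemma B_mono: "x \<le> y \<Longrightarrow> B x \<le> B y"
  using mono by (rule monoD)

lemma B_nonneg [simp]: "0 \<le> B x"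
  using pos[of x] by simp

lemma B_double: "B (2 * x) \<le> 2 ^ p * B x"
  by (rule growth) simp

lemma B_add_le:
  assumes "x \<ge> 0" "y \<ge> 0"
  shows "B (x + y) \<le> 2 ^ p * (B x + B y)"
proof -
  have "B (x + y) \<le> B (2 * max x y)"
    by (rule B_mono) auto
  also have "\<dots> \<le> 2 ^ p * B (max x y)"
    by (rule B_double)
  also have "\<dots> \<le> 2 ^ p * (B x + B y)"
    by (intro mult_left_mono) (auto simp: max_def)
  finally show ?thesis .
qed

lemma times_B_mono: "0 \<le> x \<Longrightarrow> x \<le> y \<Longrightarrow> x * B x \<le> y * B y"
  by (intro mult_mono B_mono) auto

lemma times_B_add_le:
  assumes "x \<ge> 0" "y \<ge> 0"
  shows "(x + y) * B (x + y) \<le> 2 ^ Suc p * (x * B x + y * B y)"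
proof -
  let ?z = "max x y"
  have "(x + y) * B (x + y) \<le> (2 * ?z) * B (2 * ?z)"
    using assms by (intro times_B_mono) auto
  also have "\<dots> \<le> (2 * ?z) * (2 ^ p * B ?z)"
    using assms by (intro mult_left_mono B_double) auto
  also have "\<dots> = 2 ^ Suc p * (?z * B ?z)"
    by simp
  also have "\<dots> \<le> 2 ^ Suc p * (x * B x + y * B y)"
    using assms by (intro mult_left_mono) (auto simp: max_def)
  finally show ?thesis .
qed

section \<open>The primitive of B along one step of a reflected walk\<close>

definition primitive :: "real \<Rightarrow> real" where
  "primitive x = integral {0..x} B"

lemma primitive_diff:
  assumes "0 \<le> x" "x \<le> y"
  shows "(y - x) * B x \<le> primitive y - primitive x" "primitive y - primitive x \<le> (y - x) * B y"
proof -
  have int: "B integrable_on {a..b}" for a b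
    by (rule integrable_on_mono_on) (use B_mono in \<open>auto simp: monotone_on_def\<close>)
  have "primitive y - primitive x = integral {x..y} B"
    using Henstock_Kurzweil_Integration.integral_combine[OF assms int] by (simp add: primitive_def)
  moreover have "integral {x..y} (\<lambda>_. B x) \<le> integral {x..y} B"
    by (intro integral_le int) (auto intro: B_mono)
  moreover have "integral {x..y} B \<le> integral {x..y} (\<lambda>_. B y)"
    by (intro integral_le int) (auto intro: B_mono)
  ultimately show "(y - x) * B x \<le> primitive y - primitive x" "primitive y - primitive x \<le> (y - x) * B y"
    using assms by auto
qed

lemma primitive_mono: "x \<le> y \<Longrightarrow> primitive x \<le> primitive y"
proof (cases "x \<ge> 0")
  case True
  moreover assume "x \<le> y"
  ultimately have "0 \<le> (y - x) * B x" "(y - x) * B x \<le> primitive y - primitive x"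
    using primitive_diff(1)[of x y] by auto
  then show ?thesis by linarith
next
  case False
  then have "primitive x = 0"
    by (simp add: primitive_def)
  moreover have "primitive y \<ge> 0"
    unfolding primitive_def by (rule integral_nonneg)
      (auto intro!: integrable_on_mono_on simp: monotone_on_def B_mono)
  ultimately show ?thesis by simp
qed

lemma primitive_0 [simp]: "primitive 0 = 0"
  by (simp add: primitive_def)

lemma primitive_nonneg: "primitive x \<ge> 0"
  using primitive_mono[of 0 x] by (cases "x \<ge> 0") (auto simp: primitive_def)

lemma measurable_primitive [measurable]: "primitive \<in> borel_measurable borel"
  by (rule borel_measurable_mono) (auto intro: monoI primitive_mono)

text \<open>A jump x \<le> \<delta> m inflates B m only by the factor (1 + \<delta>) ^ p,
  arbitrarily close to 1; a larger jump has m < x / \<delta> and is charged to x B x alone, an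
  integrable quantity.\<close>

lemma primitive_step_up:
  assumes "m \<ge> 0" "x \<ge> 0" "\<delta> > 0"
  shows "primitive (m + x) - primitive m \<le> (1 + \<delta>) ^ p * x * B m + (1 + 1 / \<delta>) ^ p * (x * B x)"
proof -
  have "B (m + x) \<le> (1 + \<delta>) ^ p * B m + (1 + 1 / \<delta>) ^ p * B x"
  proof (cases "x \<le> \<delta> * m")
    case True
    then have "B (m + x) \<le> B ((1 + \<delta>) * m)"
      by (intro B_mono) (simp add: algebra_simps)
    also have "\<dots> \<le> (1 + \<delta>) ^ p * B m"
      using assms by (intro growth) simp
    also have "\<dots> \<le> (1 + \<delta>) ^ p * B m + (1 + 1 / \<delta>) ^ p * B x"
      using assms by simp
    finally show ?thesis .
  next
    case False
    then have "B (m + x) \<le> B ((1 + 1 / \<delta>) * x)"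
      using assms by (intro B_mono) (simp add: field_simps)
    also have "\<dots> \<le> (1 + 1 / \<delta>) ^ p * B x"
      using assms by (intro growth) simp
    also have "\<dots> \<le> (1 + \<delta>) ^ p * B m + (1 + 1 / \<delta>) ^ p * B x"
      using assms by simp
    finally show ?thesis .
  qed
  then have "x * B (m + x) \<le> x * ((1 + \<delta>) ^ p * B m + (1 + 1 / \<delta>) ^ p * B x)"
    using assms by (intro mult_left_mono)
  moreover have "primitive (m + x) - primitive m \<le> x * B (m + x)"
    using primitive_diff(2)[of m "m + x"] assms by simp
  ultimately show ?thesis
    by (simp add: algebra_simps)
qed

text \<open>Only min x L of the descent is credited. Since L \<le> \<delta> m, B stays above (1 -
  \<delta>) ^ p * B m on the interval crossed, so the gain has a factor close to 1 as well.\<close>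

lemma primitive_step_down:
  assumes "x \<ge> 0" "0 < \<delta>" "\<delta> < 1" "L > 0" "L \<le> \<delta> * m"
  shows "primitive (max 0 (m - x)) - primitive m \<le> - ((1 - \<delta>) ^ p * min x L * B m)"
proof -
  have "\<delta> * m > 0" using assms by simp
  then have "m > 0" using assms by (simp add: zero_less_mult_iff)
  then have "L \<le> m" using assms by (smt (verit) mult_left_le_one_le)
  define m' where "m' = m - min x L"
  have m': "0 \<le> m'" "m' \<le> m" "m - L \<le> m'"
    using \<open>L \<le> m\<close> assms by (auto simp: m'_def)
  have "B m \<le> B (1 / (1 - \<delta>) * (m - L))"
    using assms by (intro B_mono) (simp add: field_simps)
  also have "\<dots> \<le> (1 / (1 - \<delta>)) ^ p * B (m - L)"
    using assms by (intro growth) simp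
  finally have "(1 - \<delta>) ^ p * B m \<le> B (m - L)"
    using assms by (simp add: field_simps)
  also have "\<dots> \<le> B m'"
    by (rule B_mono) (rule m')
  finally have "min x L * ((1 - \<delta>) ^ p * B m) \<le> min x L * B m'"
    using assms by (intro mult_left_mono) auto
  also have "min x L * B m' \<le> primitive m - primitive m'"
    using primitive_diff(1)[OF m'(1,2)] by (simp add: m'_def)
  finally have "min x L * ((1 - \<delta>) ^ p * B m) \<le> primitive m - primitive m'" .
  moreover have "primitive (max 0 (m - x)) \<le> primitive m'"
    using m' by (intro primitive_mono) (auto simp: m'_def)
  ultimately show ?thesis
    by (simp add: algebra_simps)
qed

text \<open>Both kinds of jump in one bound that is linear in B m. Below L / \<delta> no descent is
  credited, and B m in the cost of an ascent is replaced by the constant B (L / \<delta>).\<close>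

lemma primitive_step:
  assumes "0 \<le> m" "0 < \<delta>" "\<delta> < 1" "L > 0"
  shows "primitive (max 0 (m + x)) \<le> primitive m
    + ((1 + \<delta>) ^ p * max 0 x - (1 - \<delta>) ^ p * min (max 0 (- x)) L) * (if L \<le> \<delta> * m then B m else 0)
    + (1 + 1 / \<delta>) ^ p * (max 0 x * B (max 0 x)) + (1 + \<delta>) ^ p * max 0 x * B (L / \<delta>)"
proof (cases "x \<ge> 0")
  case True
  define I where "I = (if L \<le> \<delta> * m then B m else 0)"
  have "B m \<le> B (L / \<delta>)" if "\<not> L \<le> \<delta> * m"
    using that assms by (intro B_mono) (simp add: field_simps)
  then have "B m \<le> I + B (L / \<delta>)"
    by (auto simp: I_def)
  then have "(1 + \<delta>) ^ p * x * B m \<le> (1 + \<delta>) ^ p * x * (I + B (L / \<delta>))"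
    using True assms by (intro mult_left_mono) auto
  moreover have "max 0 (m + x) = m + x" "max 0 x = x" "min (max 0 (- x)) L = 0"
    using True assms by auto
  ultimately show ?thesis
    using primitive_step_up[of m x \<delta>] True assms unfolding I_def[symmetric]
    by (simp only: distrib_left) simp
next
  case False
  show ?thesis
  proof (cases "L \<le> \<delta> * m")
    case True
    then show ?thesis
      using primitive_step_down[of "- x" \<delta> L m] False assms by (simp add: max_def)
  next
    case F: False
    have "primitive (max 0 (m + x)) \<le> primitive m"
      using False assms by (intro primitive_mono) auto
    then show ?thesis
      using F False by (simp add: max_def)
  qed
qed

text \<open>The primitive of \<open>B\<close> is a Lyapunov function of the random walk reflected at 0.\<close>

lemma primitive_drift:
  assumes "prob_space N" and X: "integrable N X" "integral\<^sup>L N X < 0"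
    and XB: "integrable N (\<lambda>s. max 0 (X s) * B (max 0 (X s)))"
  obtains \<epsilon> C where "\<epsilon> > 0" "C \<ge> 0"
    "\<And>m. m \<ge> 0 \<Longrightarrow> (\<integral>\<^sup>+s. ennreal (primitive (max 0 (m + X s))) \<partial>N) + ennreal (\<epsilon> * B m) \<le> ennreal (primitive m + C)"
proof -
  interpret prob_space N by fact
  have [measurable]: "X \<in> borel_measurable N"
    using X by auto
  have ip: "integrable N (\<lambda>s. max 0 (X s))" and im: "integrable N (\<lambda>s. max 0 (- X s))"
    using X by auto
  have it: "integrable N (\<lambda>s. min (max 0 (- X s)) L)" for L
    using im by auto
  define P1 where "P1 = (\<integral>s. max 0 (X s) \<partial>N)"
  define T where "T L = (\<integral>s. min (max 0 (- X s)) L \<partial>N)" for L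
  have "(\<integral>s. max 0 (X s) \<partial>N) - (\<integral>s. max 0 (- X s) \<partial>N) = (\<integral>s. max 0 (X s) - max 0 (- X s) \<partial>N)"
    using ip im by simp
  also have "\<dots> = integral\<^sup>L N X"
    by (intro Bochner_Integration.integral_cong) auto
  finally have EX: "P1 - (\<integral>s. max 0 (- X s) \<partial>N) < 0"
    using X by (simp add: P1_def)
  \<comment> \<open>The truncated negative part recovers its full mean as the truncation level
    grows, so some L keeps \<open>T L\<close> above the mean \<open>P1\<close> of the positive
    part.\<close>
  have "(\<lambda>n. T (real n)) \<longlonglongrightarrow> (\<integral>s. max 0 (- X s) \<partial>N)"
    unfolding T_def
  proof (rule integral_dominated_convergence[where w="\<lambda>s. max 0 (- X s)"])
    show "AE s in N. (\<lambda>n. min (max 0 (- X s)) (real n)) \<longlonglongrightarrow> max 0 (- X s)"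
    proof (rule AE_I2)
      fix s
      obtain n0 :: nat where "max 0 (- X s) \<le> real n0"
        using real_arch_simple by blast
      then have "eventually (\<lambda>n. min (max 0 (- X s)) (real n) = max 0 (- X s)) sequentially"
        by (intro eventually_sequentiallyI[of n0]) (auto simp: min_def)
      then show "(\<lambda>n. min (max 0 (- X s)) (real n)) \<longlonglongrightarrow> max 0 (- X s)"
        by (rule tendsto_eventually)
    qed
  qed (use im in auto)
  then have "eventually (\<lambda>n. T (real n) > P1) sequentially"
    using EX by (intro order_tendstoD) auto
  then have "eventually (\<lambda>n. T (real n) > P1 \<and> n > 0) sequentially"
    using eventually_gt_at_top by (rule eventually_conj)
  then obtain n where n: "T (real n) > P1" "n > 0"
    by (auto simp: eventually_sequentially)
  define L where "L = real n"
  have L: "L > 0" "P1 - T L < 0"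
    using n by (auto simp: L_def)
  \<comment> \<open>At \<delta> = 0 the coefficient of B m is \<open>P1 - T L\<close>, which is
    negative; by continuity it is negative for some \<delta> > 0, and its size is the drift
    \<epsilon>.\<close>
  have "((\<lambda>\<delta>. (1 + \<delta>) ^ p * P1 - (1 - \<delta>) ^ p * T L) \<longlongrightarrow> (1 + 0) ^ p * P1 - (1 - 0) ^ p * T L) (at_right 0)"
    by (intro tendsto_intros)
  then have "eventually (\<lambda>\<delta>. (1 + \<delta>) ^ p * P1 - (1 - \<delta>) ^ p * T L < 0) (at_right 0)"
    by (rule order_tendstoD) (use L in simp)
  moreover have "eventually (\<lambda>\<delta>::real. \<delta> \<in> {0<..<1}) (at_right 0)"
    by (rule eventually_at_right_real) simp
  ultimately have "eventually (\<lambda>\<delta>. (1 + \<delta>) ^ p * P1 - (1 - \<delta>) ^ p * T L < 0 \<and> \<delta> \<in> {0<..<1}) (at_right 0)"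
    by (rule eventually_conj)
  then obtain \<delta> where \<delta>: "0 < \<delta>" "\<delta> < 1" "(1 + \<delta>) ^ p * P1 - (1 - \<delta>) ^ p * T L < 0"
    using eventually_happens[of _ "at_right (0::real)"] by (auto simp: trivial_limit_at_right_real)
  define \<epsilon> where "\<epsilon> = - ((1 + \<delta>) ^ p * P1 - (1 - \<delta>) ^ p * T L)"
  define K where "K = (1 + 1 / \<delta>) ^ p * (\<integral>s. max 0 (X s) * B (max 0 (X s)) \<partial>N) + (1 + \<delta>) ^ p * P1 * B (L / \<delta>)"
  have \<epsilon>: "\<epsilon> > 0"
    using \<delta> by (simp add: \<epsilon>_def)
  have P1: "P1 \<ge> 0"
    unfolding P1_def by (rule Bochner_Integration.integral_nonneg) auto
  have K: "K \<ge> 0"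
    unfolding K_def using \<delta> P1
    by (intro add_nonneg_nonneg mult_nonneg_nonneg Bochner_Integration.integral_nonneg) auto
  show ?thesis
  \<comment> \<open>The second summand of the constant pays for the m below L / \<delta>, where the
    drift term \<open>I\<close> vanishes although B m does not.\<close>
  proof (rule that[of \<epsilon> "K + \<epsilon> * B (L / \<delta>)"])
    fix m :: real assume m: "m \<ge> 0"
    define I where "I = (if L \<le> \<delta> * m then B m else 0)"
    let ?R = "\<lambda>s. primitive m
    + ((1 + \<delta>) ^ p * max 0 (X s) - (1 - \<delta>) ^ p * min (max 0 (- X s)) L) * I
    + (1 + 1 / \<delta>) ^ p * (max 0 (X s) * B (max 0 (X s))) + (1 + \<delta>) ^ p * max 0 (X s) * B (L / \<delta>)"
    have le: "primitive (max 0 (m + X s)) \<le> ?R s" for s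
      using m \<delta> L \<epsilon> unfolding I_def by (intro primitive_step) auto
    have iR: "integrable N ?R"
      by (intro Bochner_Integration.integrable_add Bochner_Integration.integrable_diff
          integrable_mult_left integrable_mult_right XB it ip) simp_all
    have int_R: "integral\<^sup>L N ?R = primitive m - \<epsilon> * I + K"
    proof -
      have "integral\<^sup>L N ?R = primitive m + ((1 + \<delta>) ^ p * P1 - (1 - \<delta>) ^ p * T L) * I
        + (1 + 1 / \<delta>) ^ p * (\<integral>s. max 0 (X s) * B (max 0 (X s)) \<partial>N) + (1 + \<delta>) ^ p * P1 * B (L / \<delta>)"
        unfolding P1_def T_def by (simp add: XB it ip prob_space)
      then show ?thesis
        by (simp add: \<epsilon>_def K_def left_diff_distrib)
    qed
    have "(\<integral>\<^sup>+s. ennreal (primitive (max 0 (m + X s))) \<partial>N) \<le> (\<integral>\<^sup>+s. ennreal (?R s) \<partial>N)"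
      by (intro nn_integral_mono ennreal_leI le)
    also have "\<dots> = ennreal (integral\<^sup>L N ?R)"
      by (intro nn_integral_eq_integral iR AE_I2 order_trans[OF primitive_nonneg le])
    finally have "(\<integral>\<^sup>+s. ennreal (primitive (max 0 (m + X s))) \<partial>N) + ennreal (\<epsilon> * B m)
      \<le> ennreal (integral\<^sup>L N ?R) + ennreal (\<epsilon> * B m)"
      by (rule add_right_mono)
    also have "\<dots> = ennreal (integral\<^sup>L N ?R + \<epsilon> * B m)"
      using \<epsilon> by (intro ennreal_plus[symmetric] Bochner_Integration.integral_nonneg order_trans[OF primitive_nonneg le]) auto
    also have "\<dots> \<le> ennreal (primitive m + (K + \<epsilon> * B (L / \<delta>)))"
    proof (rule ennreal_leI)
      have "B m \<le> B (L / \<delta>)" if "\<not> L \<le> \<delta> * m"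
        using that \<delta> by (intro B_mono) (simp add: field_simps)
      then have "B m \<le> I + B (L / \<delta>)"
        by (auto simp: I_def)
      then have "\<epsilon> * B m \<le> \<epsilon> * (I + B (L / \<delta>))"
        using \<epsilon> by (intro mult_left_mono) auto
      then show "integral\<^sup>L N ?R + \<epsilon> * B m \<le> primitive m + (K + \<epsilon> * B (L / \<delta>))"
        unfolding int_R by (simp add: algebra_simps)
    qed
    finally show "(\<integral>\<^sup>+s. ennreal (primitive (max 0 (m + X s))) \<partial>N) + ennreal (\<epsilon> * B m)
      \<le> ennreal (primitive m + (K + \<epsilon> * B (L / \<delta>)))" .
  qed (use \<epsilon> K in auto)
qed

end

subsection \<open>Random walks on the sequence space\<close>

definition walk :: "('b \<Rightarrow> real) \<Rightarrow> (nat \<Rightarrow> 'b) \<Rightarrow> nat \<Rightarrow> real" where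
  "walk X w n = (\<Sum>k<n. X (w k))"

text \<open>This is the maximum of the walk over the times 0 to n. Recursion on the first step
  instead of the last is Lindley's recursion: prepending an independent step acts on the maximum
  like one step of the walk reflected at 0.\<close>

fun walk_max :: "('b \<Rightarrow> real) \<Rightarrow> nat \<Rightarrow> (nat \<Rightarrow> 'b) \<Rightarrow> real" where
  "walk_max X 0 w = 0"
| "walk_max X (Suc n) w = max 0 (X (w 0) + walk_max X n (\<lambda>k. w (Suc k)))"

lemma walk_0 [simp]: "walk X w 0 = 0"
  by (simp add: walk_def)

lemma walk_Suc_shift: "walk X w (Suc n) = X (w 0) + walk X (\<lambda>k. w (Suc k)) n"
  unfolding walk_def by (rule sum.lessThan_Suc_shift)

lemma walk_max_nonneg: "walk_max X n w \<ge> 0"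
  by (cases n) auto

lemma walk_max_mono: "walk_max X n w \<le> walk_max X (Suc n) w"
proof (induction n arbitrary: w)
  case (Suc n)
  show ?case
    using Suc.IH[of "\<lambda>k. w (Suc k)"] by (subst (1 2) walk_max.simps(2)) (auto simp del: walk_max.simps)
qed auto

lemma walk_le_walk_max: "k \<le> n \<Longrightarrow> walk X w k \<le> walk_max X n w"
proof (induction n arbitrary: w k)
  case (Suc n)
  show ?case
  proof (cases k)
    case 0
    then show ?thesis using walk_max_nonneg[of X "Suc n" w] by simp
  next
    case (Suc j)
    then have "walk X (\<lambda>k. w (Suc k)) j \<le> walk_max X n (\<lambda>k. w (Suc k))"
      using Suc.prems by (intro Suc.IH) simp
    then show ?thesis by (simp add: Suc walk_Suc_shift)
  qed
qed simp

lemma walk_max_le_abs_sum: "walk_max X n w \<le> (\<Sum>k<n. \<bar>X (w k)\<bar>)"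
proof (induction n arbitrary: w)
  case (Suc n)
  have "0 \<le> (\<Sum>k<n. \<bar>X (w (Suc k))\<bar>)"
    by (rule sum_nonneg) simp
  then show ?case
    using Suc.IH[of "\<lambda>k. w (Suc k)"] abs_ge_self[of "X (w 0)"]
    unfolding sum.lessThan_Suc_shift by auto
qed simp

section \<open>Integration over i.i.d. sequences, and walks of negative mean\<close>

context sequence_space
begin

lemma pair_sigma_finite_step: "pair_sigma_finite M S"
  by (intro pair_sigma_finite.intro M.sigma_finite_measure_axioms P.sigma_finite_measure_axioms)

lemma measurable_case_nat_pair: "(\<lambda>(s, \<omega>). case_nat s \<omega>) \<in> M \<Otimes>\<^sub>M S \<rightarrow>\<^sub>M S"
  by measurable

text \<open>The tail is integrated outside and the first coordinate inside, so that the one-step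
  drift estimate can be used with the maximum of the tail held fixed.\<close>

lemma nn_integral_case_nat:
  assumes [measurable]: "f \<in> borel_measurable S"
  shows "(\<integral>\<^sup>+w. f w \<partial>S) = (\<integral>\<^sup>+w. \<integral>\<^sup>+s. f (case_nat s w) \<partial>M \<partial>S)"
proof -
  interpret pair: pair_sigma_finite M S by (rule pair_sigma_finite_step)
  have "(\<integral>\<^sup>+w. f w \<partial>S) = (\<integral>\<^sup>+w. f w \<partial>distr (M \<Otimes>\<^sub>M S) S (\<lambda>(s, \<omega>). case_nat s \<omega>))"
    by (simp add: PiM_iter)
  also have "\<dots> = (\<integral>\<^sup>+x. f (case_nat (fst x) (snd x)) \<partial>(M \<Otimes>\<^sub>M S))"
    by (subst nn_integral_distr) (auto simp: case_prod_beta')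
  also have "\<dots> = (\<integral>\<^sup>+w. \<integral>\<^sup>+s. f (case_nat s w) \<partial>M \<partial>S)"
    by (subst pair.nn_integral_snd[symmetric]) auto
  finally show ?thesis .
qed

lemma nn_integral_comb_seq:
  assumes [measurable]: "f \<in> borel_measurable S"
  shows "(\<integral>\<^sup>+w. f w \<partial>S) = (\<integral>\<^sup>+w. \<integral>\<^sup>+w'. f (comb_seq n w w') \<partial>S \<partial>S)"
proof -
  have "(\<integral>\<^sup>+w. f w \<partial>S) = (\<integral>\<^sup>+w. f w \<partial>distr (S \<Otimes>\<^sub>M S) S (\<lambda>(\<omega>, \<omega>'). comb_seq n \<omega> \<omega>'))"
    by (simp add: PiM_comb_seq)
  also have "\<dots> = (\<integral>\<^sup>+x. f (comb_seq n (fst x) (snd x)) \<partial>(S \<Otimes>\<^sub>M S))"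
    by (subst nn_integral_distr) (auto simp: case_prod_beta' intro: measurable_comb_seq')
  also have "\<dots> = (\<integral>\<^sup>+w. \<integral>\<^sup>+w'. f (comb_seq n w w') \<partial>S \<partial>S)"
    by (subst P.nn_integral_fst[symmetric]) auto
  finally show ?thesis .
qed

lemma nn_integral_coordinate:
  assumes "f \<in> borel_measurable M"
  shows "(\<integral>\<^sup>+w. f (w k) \<partial>S) = (\<integral>\<^sup>+s. f s \<partial>M)"
proof -
  have "(\<integral>\<^sup>+s. f s \<partial>M) = (\<integral>\<^sup>+s. f s \<partial>distr S M (\<lambda>w. w k))"
    by (simp add: PiM_component)
  also have "\<dots> = (\<integral>\<^sup>+w. f (w k) \<partial>S)"
    using assms by (intro nn_integral_distr) auto
  finally show ?thesis by simp
qed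

lemma integrable_coordinate:
  fixes f :: "'a \<Rightarrow> real"
  assumes "integrable M f"
  shows "integrable S (\<lambda>w. f (w k))"
proof -
  have "integrable (distr S M (\<lambda>w. w k)) f"
    using assms by (simp add: PiM_component)
  then show ?thesis
    by (rule integrable_distr[rotated]) simp
qed

lemma measurable_walk [measurable]:
  assumes [measurable]: "X \<in> borel_measurable M"
  shows "(\<lambda>w. walk X w n) \<in> borel_measurable S"
  unfolding walk_def by measurable

lemma measurable_walk_max [measurable]:
  assumes [measurable]: "X \<in> borel_measurable M"
  shows "walk_max X n \<in> borel_measurable S"
proof (induction n)
  case 0
  have "walk_max X 0 = (\<lambda>w. 0)" by auto
  then show ?case by simp
next
  case (Suc n)
  have "(\<lambda>w k. w (Suc k)) \<in> S \<rightarrow>\<^sub>M S"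
    by (intro measurable_PiM_single') (auto simp: space_PiM PiE_iff)
  then have [measurable]: "(\<lambda>w. walk_max X n (\<lambda>k. w (Suc k))) \<in> borel_measurable S"
    using Suc by (rule measurable_compose)
  have "walk_max X (Suc n) = (\<lambda>w. max 0 (X (w 0) + walk_max X n (\<lambda>k. w (Suc k))))"
    by auto
  also have "\<dots> \<in> borel_measurable S"
    by measurable
  finally show ?case .
qed

lemma integrable_walk_max:
  assumes "integrable M X"
  shows "integrable S (walk_max X n)"
proof (rule Bochner_Integration.integrable_bound)
  show "integrable S (\<lambda>w. \<Sum>k<n. \<bar>X (w k)\<bar>)"
    using assms by (intro Bochner_Integration.integrable_sum integrable_abs integrable_coordinate)
  show "walk_max X n \<in> borel_measurable S"
    using assms by measurable
  show "AE w in S. norm (walk_max X n w) \<le> norm (\<Sum>k<n. \<bar>X (w k)\<bar>)"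
    using walk_max_le_abs_sum[of X n] walk_max_nonneg[of X n] by (auto intro: order_trans)
qed

text \<open>On the shift-invariant event \<open>A\<close> that the walk is unbounded,
  \<open>walk_max X (Suc n) - walk_max X n\<close> has nonnegative mean, while prepending an independent step
  \<open>s\<close> shows that this mean converges to the mean of \<open>X s\<close> times the probability of \<open>A\<close>.\<close>

lemma AE_walk_bounded:
  assumes X: "integrable M X" "integral\<^sup>L M X < 0"
  shows "AE w in S. bdd_above (range (walk X w))"
proof -
  have [measurable]: "X \<in> borel_measurable M"
    using X by auto
  interpret pair: pair_sigma_finite M S by (rule pair_sigma_finite_step)
  define U where "U w \<longleftrightarrow> (\<forall>c::nat. \<exists>n. walk X w n > real c)" for w
  have [measurable]: "Measurable.pred S U"
    unfolding U_def by measurable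
  define A where "A w = (if U w then 1 else 0 :: real)" for w
  have [measurable]: "A \<in> borel_measurable S"
    unfolding A_def by measurable
  have U_case: "U (case_nat s w) \<longleftrightarrow> U w" for s w
  proof
    assume L: "U (case_nat s w)"
    show "U w"
      unfolding U_def
    proof
      fix c :: nat
      obtain d :: nat where d: "real c + \<bar>X s\<bar> \<le> real d"
        using real_arch_simple by blast
      obtain n where n: "walk X (case_nat s w) n > real d"
        using L by (auto simp: U_def)
      then obtain n' where "n = Suc n'"
        by (cases n) auto
      then have "walk X w n' > real c"
        using n d by (auto simp: walk_Suc_shift)
      then show "\<exists>n. walk X w n > real c" ..
    qed
  next
    assume R: "U w"
    show "U (case_nat s w)"
      unfolding U_def
    proof
      fix c :: nat
      obtain d :: nat where d: "real c + \<bar>X s\<bar> \<le> real d"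
        using real_arch_simple by blast
      obtain n where n: "walk X w n > real d"
        using R by (auto simp: U_def)
      then have "walk X (case_nat s w) (Suc n) > real c"
        using d by (auto simp: walk_Suc_shift)
      then show "\<exists>n. walk X (case_nat s w) n > real c" ..
    qed
  qed
  then have A_case: "A (case_nat s w) = A w" for s w
    by (simp add: A_def)
  define f where "f n x = (walk_max X (Suc n) (case_nat (fst x) (snd x)) - walk_max X n (snd x)) * A (snd x)" for n x
  have iX: "integrable (M \<Otimes>\<^sub>M S) (\<lambda>x. X (fst x))"
    using integrable_distr[of fst "M \<Otimes>\<^sub>M S" M X] X by (simp add: P.distr_pair_fst)
  \<comment> \<open>A step X followed by reflection at 0 displaces a point m \<ge> 0 by at most |X|.
    This gives an integrable majorant although the maxima themselves may grow without bound.\<close>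
  have bound: "\<bar>f n x\<bar> \<le> \<bar>X (fst x)\<bar>" for n x
    using walk_max_nonneg[of X n "snd x"] by (auto simp: f_def A_def abs_if max_def)
  have [measurable]: "f n \<in> borel_measurable (M \<Otimes>\<^sub>M S)" for n
    unfolding f_def by measurable
  have fi: "integrable (M \<Otimes>\<^sub>M S) (f n)" for n
    using iX by (rule Bochner_Integration.integrable_bound) (use bound in auto)
  have iM: "integrable S (\<lambda>w. walk_max X n w * A w)" for n
    by (rule Bochner_Integration.integrable_bound[OF integrable_walk_max[OF X(1), of n]]) (auto simp: A_def)
  have iM': "integrable (M \<Otimes>\<^sub>M S) (\<lambda>x. walk_max X (Suc n) (case_nat (fst x) (snd x)) * A (snd x))"
    and eq1: "(\<integral>x. walk_max X (Suc n) (case_nat (fst x) (snd x)) * A (snd x) \<partial>(M \<Otimes>\<^sub>M S)) = (\<integral>w. walk_max X (Suc n) w * A w \<partial>S)" for n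
  proof -
    let ?D = "distr (M \<Otimes>\<^sub>M S) S (\<lambda>(s, \<omega>). case_nat s \<omega>)"
    have "integrable ?D (\<lambda>w. walk_max X (Suc n) w * A w)"
      using iM by (simp add: PiM_iter del: walk_max.simps)
    from integrable_distr[OF measurable_case_nat_pair this]
    show "integrable (M \<Otimes>\<^sub>M S) (\<lambda>x. walk_max X (Suc n) (case_nat (fst x) (snd x)) * A (snd x))"
      by (simp add: case_prod_beta' A_case del: walk_max.simps)
    have "(\<integral>w. walk_max X (Suc n) w * A w \<partial>S) = (\<integral>w. walk_max X (Suc n) w * A w \<partial>?D)"
      by (simp add: PiM_iter del: walk_max.simps)
    also have "\<dots> = (\<integral>x. walk_max X (Suc n) (case_nat (fst x) (snd x)) * A (snd x) \<partial>(M \<Otimes>\<^sub>M S))"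
      by (subst integral_distr[OF measurable_case_nat_pair]) (auto simp: case_prod_beta' A_case simp del: walk_max.simps)
    finally show "(\<integral>x. walk_max X (Suc n) (case_nat (fst x) (snd x)) * A (snd x) \<partial>(M \<Otimes>\<^sub>M S)) = (\<integral>w. walk_max X (Suc n) w * A w \<partial>S)" ..
  qed
  \<comment> \<open>Prepending a coordinate preserves the law of the sequence and the event
    \<open>U\<close>, so the integral is the difference of the means of two consecutive maxima
    restricted to \<open>U\<close>.\<close>
  have nn: "0 \<le> integral\<^sup>L (M \<Otimes>\<^sub>M S) (f n)" for n
  proof -
    have iM2: "integrable (M \<Otimes>\<^sub>M S) (\<lambda>x. walk_max X n (snd x) * A (snd x))"
    proof -
      have "integrable (M \<Otimes>\<^sub>M S) (\<lambda>x. walk_max X (Suc n) (case_nat (fst x) (snd x)) * A (snd x) - f n x)"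
        by (intro Bochner_Integration.integrable_diff fi iM')
      then show ?thesis by (simp add: f_def left_diff_distrib del: walk_max.simps)
    qed
    have "(\<integral>x. walk_max X n (snd x) * A (snd x) \<partial>(M \<Otimes>\<^sub>M S)) = (\<integral>s. (\<integral>w. walk_max X n w * A w \<partial>S) \<partial>M)"
      using pair.integral_fst'[OF iM2] by simp
    also have "\<dots> = (\<integral>w. walk_max X n w * A w \<partial>S)"
      by (simp add: M.prob_space)
    finally have "integral\<^sup>L (M \<Otimes>\<^sub>M S) (f n) = (\<integral>w. walk_max X (Suc n) w * A w \<partial>S) - (\<integral>w. walk_max X n w * A w \<partial>S)"
      unfolding f_def left_diff_distrib by (subst Bochner_Integration.integral_diff[OF iM' iM2]) (simp only: eq1)
    moreover have "(\<integral>w. walk_max X n w * A w \<partial>S) \<le> (\<integral>w. walk_max X (Suc n) w * A w \<partial>S)"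
      by (intro integral_mono iM mult_right_mono walk_max_mono) (auto simp: A_def)
    ultimately show ?thesis by simp
  qed
  \<comment> \<open>On \<open>U\<close> the maximum of the tail eventually exceeds |X|, so the
    reflection is inactive and the displacement equals the step.\<close>
  have lim: "(\<lambda>n. f n x) \<longlonglongrightarrow> X (fst x) * A (snd x)" for x
  proof (cases "U (snd x)")
    case True
    obtain d :: nat where d: "\<bar>X (fst x)\<bar> \<le> real d"
      using real_arch_simple by blast
    obtain k where "walk X (snd x) k > real d"
      using True by (auto simp: U_def)
    then have "f n x = X (fst x) * A (snd x)" if "n \<ge> k" for n
      using walk_le_walk_max[OF that, of X "snd x"] d True by (auto simp: f_def A_def)
    then have "eventually (\<lambda>n. f n x = X (fst x) * A (snd x)) sequentially"
      by (intro eventually_sequentiallyI[of k])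
    then show ?thesis by (rule tendsto_eventually)
  qed (simp add: f_def A_def)
  have "(\<lambda>n. integral\<^sup>L (M \<Otimes>\<^sub>M S) (f n)) \<longlonglongrightarrow> (\<integral>x. X (fst x) * A (snd x) \<partial>(M \<Otimes>\<^sub>M S))"
    by (rule integral_dominated_convergence[where w="\<lambda>x. \<bar>X (fst x)\<bar>"])
      (use iX bound lim in auto)
  then have "0 \<le> (\<integral>x. X (fst x) * A (snd x) \<partial>(M \<Otimes>\<^sub>M S))"
    using nn by (intro LIMSEQ_le_const) auto
  also have "\<dots> = (\<integral>s. \<integral>w. X s * A w \<partial>S \<partial>M)"
  proof -
    have "integrable (M \<Otimes>\<^sub>M S) (\<lambda>x. X (fst x) * A (snd x))"
      using iX by (rule Bochner_Integration.integrable_bound) (auto simp: A_def)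
    from pair.integral_fst'[OF this] show ?thesis by simp
  qed
  \<comment> \<open>The step is independent of the tail, so a negative mean times the probability of
    \<open>U\<close> is nonnegative, which forces that probability to be 0.\<close>
  also have "\<dots> = integral\<^sup>L M X * integral\<^sup>L S A"
    by simp
  finally have "integral\<^sup>L S A \<le> 0"
    using X by (simp add: zero_le_mult_iff)
  moreover have iA: "integrable S A"
    by (rule P.integrable_const_bound[where B=1]) (auto simp: A_def)
  moreover have "0 \<le> integral\<^sup>L S A"
    by (rule Bochner_Integration.integral_nonneg) (simp add: A_def)
  ultimately have "AE w in S. A w = 0"
    using integral_nonneg_eq_0_iff_AE[OF iA] by (simp add: A_def)
  then show ?thesis
  proof eventually_elim
    case (elim w)
    then have "\<not> U w" by (simp add: A_def split: if_splits)
    then obtain c :: nat where "\<And>n. walk X w n \<le> real c"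
      by (auto simp: U_def not_less)
    then show ?case by (intro bdd_aboveI2)
  qed
qed

text \<open>With \<open>F n\<close> and \<open>b n\<close> the means of the primitive and of B at
  the maximum up to time n, the drift reads F (n+1) + \<epsilon> b n \<le> F n + C. The maximum
  increases with n, hence so does F; cancelling the finite \<open>F n\<close> leaves b n \<le> C /
  \<epsilon> uniformly in n, and monotone convergence yields the supremum.\<close>

lemma walk_sup_moment:
  assumes B: "moderate_growth B p" and X: "integrable M X" "integral\<^sup>L M X < 0"
    and XB: "integrable M (\<lambda>s. max 0 (X s) * B (max 0 (X s)))"
  shows "(\<integral>\<^sup>+w. (SUP n. ennreal (B (walk X w n))) \<partial>S) < \<infinity>"
proof -
  interpret B: moderate_growth B p by fact
  have [measurable]: "X \<in> borel_measurable M"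
    using X by auto
  note [measurable] = B.measurable_B B.measurable_primitive
  obtain \<epsilon> C where \<epsilon>: "\<epsilon> > 0" and C: "C \<ge> 0" and drift:
    "\<And>m. m \<ge> 0 \<Longrightarrow> (\<integral>\<^sup>+s. ennreal (B.primitive (max 0 (m + X s))) \<partial>M) + ennreal (\<epsilon> * B m) \<le> ennreal (B.primitive m + C)"
    using B.primitive_drift[OF M.prob_space_axioms X XB] by blast
  define F where "F n = (\<integral>\<^sup>+w. ennreal (B.primitive (walk_max X n w)) \<partial>S)" for n
  define b where "b n = (\<integral>\<^sup>+w. ennreal (B (walk_max X n w)) \<partial>S)" for n
  have step: "F (Suc n) + ennreal \<epsilon> * b n \<le> F n + ennreal C" for n
  proof -
    have "F (Suc n) + ennreal \<epsilon> * b n =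
      (\<integral>\<^sup>+w. (\<integral>\<^sup>+s. ennreal (B.primitive (max 0 (walk_max X n w + X s))) \<partial>M) + ennreal (\<epsilon> * B (walk_max X n w)) \<partial>S)"
    proof -
      have "F (Suc n) = (\<integral>\<^sup>+w. \<integral>\<^sup>+s. ennreal (B.primitive (max 0 (walk_max X n w + X s))) \<partial>M \<partial>S)"
      proof -
        have "(\<lambda>w. ennreal (B.primitive (walk_max X (Suc n) w))) \<in> borel_measurable S"
          by measurable
        from nn_integral_case_nat[OF this] show ?thesis
          by (simp add: F_def add.commute)
      qed
      moreover have "ennreal \<epsilon> * b n = (\<integral>\<^sup>+w. ennreal (\<epsilon> * B (walk_max X n w)) \<partial>S)"
        unfolding b_def using \<epsilon> by (simp add: nn_integral_cmult[symmetric] ennreal_mult')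
      ultimately show ?thesis
        by (simp add: nn_integral_add)
    qed
    also have "\<dots> \<le> (\<integral>\<^sup>+w. ennreal (B.primitive (walk_max X n w) + C) \<partial>S)"
      by (intro nn_integral_mono drift walk_max_nonneg)
    also have "\<dots> = F n + ennreal C"
      unfolding F_def using C by (simp add: B.primitive_nonneg nn_integral_add P.emeasure_space_1)
    finally show ?thesis .
  qed
  have fin: "F n < \<infinity>" for n
  proof (induction n)
    case (Suc n)
    have "F (Suc n) \<le> F n + ennreal C"
      using step[of n] by (meson dual_order.trans le_add_same_cancel1 zero_le add_increasing2 order_refl)
    then show ?case using Suc by (auto simp: less_top[symmetric] top_unique)
  qed (simp add: F_def)
  have b_le: "b n \<le> ennreal (C / \<epsilon>)" for n
  proof -
    have "F n \<le> F (Suc n)"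
      unfolding F_def by (intro nn_integral_mono ennreal_leI B.primitive_mono walk_max_mono)
    then have "F n + ennreal \<epsilon> * b n \<le> F n + ennreal C"
      using step[of n] by (meson add_right_mono order_trans)
    then have "ennreal \<epsilon> * b n \<le> ennreal C"
      using fin[of n] by (auto simp: ennreal_add_left_cancel_le)
    then have "ennreal (1 / \<epsilon>) * (ennreal \<epsilon> * b n) \<le> ennreal (1 / \<epsilon>) * ennreal C"
      by (rule mult_left_mono) simp
    then show ?thesis
      using \<epsilon> C by (simp add: mult.assoc[symmetric] ennreal_mult'[symmetric])
  qed
  have "(\<integral>\<^sup>+w. (SUP n. ennreal (B (walk X w n))) \<partial>S) \<le> (\<integral>\<^sup>+w. (SUP n. ennreal (B (walk_max X n w))) \<partial>S)"
    by (intro nn_integral_mono SUP_mono) (auto intro!: ennreal_leI B.B_mono walk_le_walk_max)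
  also have "\<dots> = (SUP n. b n)"
    unfolding b_def
    by (intro nn_integral_monotone_convergence_SUP incseq_SucI le_funI ennreal_leI B.B_mono walk_max_mono) measurable
  also have "\<dots> \<le> ennreal (C / \<epsilon>)"
    by (intro SUP_least b_le)
  also have "\<dots> < \<infinity>"
    by simp
  finally show ?thesis .
qed

end

section \<open>Counting exceedances of a line by i.i.d. variables\<close>

lemma suminf_indicator_greaterThan:
  assumes "a > 0"
  shows "(\<Sum>n. indicator {a * real n<..} x :: ennreal) = ennreal (real (nat \<lceil>x / a\<rceil>))"
proof -
  have iff: "a * real n < x \<longleftrightarrow> n < nat \<lceil>x / a\<rceil>" for n
  proof -
    have "a * real n < x \<longleftrightarrow> real_of_int (int n) < x / a"
      using assms by (simp add: field_simps)
    also have "\<dots> \<longleftrightarrow> int n < \<lceil>x / a\<rceil>"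
      by (rule less_ceiling_iff[symmetric])
    finally show ?thesis by (simp add: zless_nat_eq_int_zless)
  qed
  have "(\<Sum>n. indicator {a * real n<..} x :: ennreal) = (\<Sum>n<nat \<lceil>x / a\<rceil>. indicator {a * real n<..} x)"
    by (rule suminf_finite) (auto simp: iff)
  also have "\<dots> = (\<Sum>n<nat \<lceil>x / a\<rceil>. 1)"
    by (intro sum.cong) (auto simp: iff)
  finally show ?thesis by (simp add: ennreal_of_nat_eq_real_of_nat)
qed

lemma real_nat_ceiling_le: "0 \<le> y \<Longrightarrow> real (nat \<lceil>y\<rceil>) \<le> y + 1"
  by linarith

lemma real_nat_ceiling_ge: "y \<le> real (nat \<lceil>y\<rceil>)"
  by linarith

lemma (in moderate_growth) B_le_one_plus:
  assumes "x \<ge> 0"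
  shows "B x \<le> B 1 + x * B x"
proof (cases "x \<le> 1")
  case True
  then show ?thesis using B_mono[OF True] assms by (simp add: add_increasing2)
next
  case False
  then have "1 * B x \<le> x * B x" by (intro mult_right_mono) auto
  then show ?thesis using pos[of 1] by linarith
qed

text \<open>\<open>B\<close> need not be continuous; its value at a supremum is within the doubling constant of its
  values along the sequence.\<close>

lemma (in moderate_growth) B_SUP_le:
  assumes "bdd_above (range f)" "f k \<ge> 0"
  shows "ennreal (B (SUP n. f n)) \<le> ennreal (2 ^ p) * (SUP n. ennreal (B (f n)))"
proof -
  let ?s = "SUP n. f n"
  have s: "?s \<ge> f k"
    using assms by (intro cSUP_upper) auto
  \<comment> \<open>A positive supremum exceeds its half, which some value then beats; a supremum
    equal to 0 is attained at k. Nonnegativity of f k excludes a negative supremum, whose half would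
    lie above it.\<close>
  obtain n where n: "?s / 2 \<le> f n"
  proof (cases "?s > 0")
    case True
    then have "?s / 2 < ?s" by simp
    then show ?thesis
      using that assms less_cSUP_iff[of UNIV f "?s / 2"] by (auto intro: less_imp_le)
  next
    case False
    then have "?s / 2 \<le> f k" using s assms by simp
    then show ?thesis by (rule that)
  qed
  have "B ?s \<le> 2 ^ p * B (?s / 2)"
    using B_double[of "?s / 2"] by simp
  also have "\<dots> \<le> 2 ^ p * B (f n)"
    using n by (intro mult_left_mono B_mono) auto
  finally have "ennreal (B ?s) \<le> ennreal (2 ^ p) * ennreal (B (f n))"
    by (simp add: ennreal_mult'[symmetric] ennreal_leI del: ennreal_power)
  also have "\<dots> \<le> ennreal (2 ^ p) * (SUP n. ennreal (B (f n)))"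
    by (intro mult_left_mono SUP_upper) auto
  finally show ?thesis .
qed

context sequence_space
begin

lemma suminf_tail_eq:
  assumes [measurable]: "\<eta> \<in> borel_measurable M" and a: "a > 0"
  shows "(\<Sum>n. emeasure M {s \<in> space M. \<eta> s > x + a * real n}) = (\<integral>\<^sup>+s. ennreal (real (nat \<lceil>(\<eta> s - x) / a\<rceil>)) \<partial>M)"
proof -
  have "emeasure M {s \<in> space M. \<eta> s > x + a * real n} = (\<integral>\<^sup>+s. indicator {a * real n<..} (\<eta> s - x) \<partial>M)" for n
  proof -
    have "(\<integral>\<^sup>+s. indicator {a * real n<..} (\<eta> s - x) \<partial>M) = (\<integral>\<^sup>+s. indicator {s \<in> space M. \<eta> s > x + a * real n} s \<partial>M)"
      by (intro nn_integral_cong) (auto split: split_indicator)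
    then show ?thesis by simp
  qed
  then have "(\<Sum>n. emeasure M {s \<in> space M. \<eta> s > x + a * real n}) = (\<Sum>n. \<integral>\<^sup>+s. indicator {a * real n<..} (\<eta> s - x) \<partial>M)"
    by simp
  also have "\<dots> = (\<integral>\<^sup>+s. (\<Sum>n. indicator {a * real n<..} (\<eta> s - x)) \<partial>M)"
    by (rule nn_integral_suminf[symmetric]) measurable
  finally show ?thesis
    by (simp only: suminf_indicator_greaterThan[OF a])
qed

text \<open>Borel-Cantelli in integrated form: the expected number of n with \<eta> above a n is at
  most the mean of \<eta> / a + 1. Almost surely only finitely many n remain, and those are bounded
  by a finite sum.\<close>

lemma AE_subtract_drift_bounded:
  assumes eta: "integrable M \<eta>" "\<And>s. \<eta> s \<ge> 0" and a: "a > 0"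
  shows "AE w in S. bdd_above (range (\<lambda>n. \<eta> (w n) - a * real n))"
proof -
  have [measurable]: "\<eta> \<in> borel_measurable M"
    using eta by auto
  have "(\<integral>\<^sup>+w. (\<Sum>n. indicator {a * real n<..} (\<eta> (w n))) \<partial>S) = (\<Sum>n. \<integral>\<^sup>+w. indicator {a * real n<..} (\<eta> (w n)) \<partial>S)"
    by (rule nn_integral_suminf) measurable
  also have "\<dots> = (\<Sum>n. \<integral>\<^sup>+s. indicator {a * real n<..} (\<eta> s) \<partial>M)"
    by (subst nn_integral_coordinate) auto
  also have "\<dots> = (\<integral>\<^sup>+s. (\<Sum>n. indicator {a * real n<..} (\<eta> s)) \<partial>M)"
    by (rule nn_integral_suminf[symmetric]) measurable
  also have "\<dots> = (\<integral>\<^sup>+s. ennreal (real (nat \<lceil>\<eta> s / a\<rceil>)) \<partial>M)"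
    by (simp only: suminf_indicator_greaterThan[OF a])
  also have "\<dots> \<le> (\<integral>\<^sup>+s. ennreal (\<eta> s / a + 1) \<partial>M)"
    using eta a by (intro nn_integral_mono ennreal_leI real_nat_ceiling_le) auto
  also have "\<dots> = ennreal (\<integral>s. \<eta> s / a + 1 \<partial>M)"
    using eta a by (intro nn_integral_eq_integral AE_I2) auto
  also have "\<dots> < \<infinity>"
    by simp
  finally have "AE w in S. (\<Sum>n. indicator {a * real n<..} (\<eta> (w n))) \<noteq> (\<infinity> :: ennreal)"
    by (intro nn_integral_noteq_infinite) auto
  then show ?thesis
  proof eventually_elim
    case (elim w)
    let ?f = "\<lambda>n. indicator {a * real n<..} (\<eta> (w n)) :: real"
    have "(\<Sum>n. ennreal (?f n)) \<noteq> top"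
      using elim by (simp add: ennreal_indicator)
    then have "summable ?f"
      by (intro summable_suminf_not_top) auto
    then have "?f \<longlonglongrightarrow> 0"
      by (rule summable_LIMSEQ_zero)
    then have "eventually (\<lambda>n. ?f n < 1) sequentially"
      by (rule order_tendstoD) simp
    then obtain N where N: "\<And>n. n \<ge> N \<Longrightarrow> ?f n < 1"
      by (auto simp: eventually_sequentially)
    have le: "\<eta> (w n) - a * real n \<le> (\<Sum>k<N. \<eta> (w k))" for n
    proof (cases "n < N")
      case True
      have "\<eta> (w n) - a * real n \<le> \<eta> (w n)" using a by simp
      also have "\<dots> \<le> (\<Sum>k<N. \<eta> (w k))"
        using True eta by (intro member_le_sum) auto
      finally show ?thesis .
    next
      case False
      then have "\<eta> (w n) - a * real n \<le> 0"
        using N[of n] by (auto split: split_indicator_asm)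
      also have "0 \<le> (\<Sum>k<N. \<eta> (w k))"
        using eta by (intro sum_nonneg) auto
      finally show ?thesis .
    qed
    then show ?case by (rule bdd_aboveI2)
  qed
qed

text \<open>The supremum is replaced by a sum in which the subtraction inside B is forgotten: each n
  with a n < \<eta> contributes B \<eta>. By stationarity one variable then contributes B \<eta>
  about \<eta> / a times, which is where the moment of \<eta> B \<eta> comes in.\<close>

lemma subtract_drift_sup_moment:
  assumes B: "moderate_growth B p" and a: "a > 0"
    and [measurable]: "\<eta> \<in> borel_measurable M" and nn: "\<And>s. \<eta> s \<ge> 0"
    and fin: "(\<integral>\<^sup>+s. ennreal (\<eta> s * B (\<eta> s)) \<partial>M) < \<infinity>"
  shows "(\<integral>\<^sup>+w. (SUP n. ennreal (B (max 0 (\<eta> (w n) - a * real n)))) \<partial>S) < \<infinity>"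
proof -
  interpret B: moderate_growth B p by fact
  note [measurable] = B.measurable_B
  have le_suminf: "f n \<le> suminf f" for f :: "nat \<Rightarrow> ennreal" and n
    using sum_le_suminf[of f "{n}"] by simp
  let ?g = "\<lambda>n x. ennreal (B x) * indicator {a * real n<..} x"
  have "(SUP n. ennreal (B (max 0 (\<eta> (w n) - a * real n)))) \<le> ennreal (B 0) + (\<Sum>n. ?g n (\<eta> (w n)))" for w
  proof (rule SUP_least)
    fix n
    have "ennreal (B (max 0 (\<eta> (w n) - a * real n))) \<le> ennreal (B 0) + ?g n (\<eta> (w n))"
    proof (cases "\<eta> (w n) > a * real n")
      case True
      have "ennreal (B (max 0 (\<eta> (w n) - a * real n))) \<le> ennreal (B (\<eta> (w n)))"
        using nn[of "w n"] a by (intro ennreal_leI B.B_mono) auto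
      also have "\<dots> \<le> ennreal (B 0) + ?g n (\<eta> (w n))"
        using True by simp
      finally show ?thesis .
    qed (simp add: max_def)
    also have "?g n (\<eta> (w n)) \<le> (\<Sum>n. ?g n (\<eta> (w n)))"
      by (rule le_suminf)
    finally show "ennreal (B (max 0 (\<eta> (w n) - a * real n))) \<le> ennreal (B 0) + (\<Sum>n. ?g n (\<eta> (w n)))"
      by (simp add: add_left_mono)
  qed
  then have "(\<integral>\<^sup>+w. (SUP n. ennreal (B (max 0 (\<eta> (w n) - a * real n)))) \<partial>S) \<le> (\<integral>\<^sup>+w. ennreal (B 0) + (\<Sum>n. ?g n (\<eta> (w n))) \<partial>S)"
    by (intro nn_integral_mono)
  also have "\<dots> = ennreal (B 0) + (\<integral>\<^sup>+w. (\<Sum>n. ?g n (\<eta> (w n))) \<partial>S)"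
    by (subst nn_integral_add) (auto simp: P.emeasure_space_1)
  also have "(\<integral>\<^sup>+w. (\<Sum>n. ?g n (\<eta> (w n))) \<partial>S) = (\<Sum>n. \<integral>\<^sup>+w. ?g n (\<eta> (w n)) \<partial>S)"
    by (rule nn_integral_suminf) measurable
  also have "\<dots> = (\<Sum>n. \<integral>\<^sup>+s. ?g n (\<eta> s) \<partial>M)"
    by (subst nn_integral_coordinate) auto
  also have "\<dots> = (\<integral>\<^sup>+s. (\<Sum>n. ?g n (\<eta> s)) \<partial>M)"
    by (rule nn_integral_suminf[symmetric]) measurable
  also have "\<dots> = (\<integral>\<^sup>+s. ennreal (B (\<eta> s)) * ennreal (real (nat \<lceil>\<eta> s / a\<rceil>)) \<partial>M)"
    by (simp only: ennreal_suminf_cmult suminf_indicator_greaterThan[OF a])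
  also have "\<dots> \<le> (\<integral>\<^sup>+s. ennreal (B 1) + ennreal (1 / a + 1) * ennreal (\<eta> s * B (\<eta> s)) \<partial>M)"
  proof (rule nn_integral_mono)
    fix s
    have "B (\<eta> s) * real (nat \<lceil>\<eta> s / a\<rceil>) \<le> B (\<eta> s) * (\<eta> s / a + 1)"
      using nn[of s] a by (intro mult_left_mono real_nat_ceiling_le) auto
    also have "\<dots> = (\<eta> s * B (\<eta> s)) / a + B (\<eta> s)"
      by (simp add: algebra_simps)
    also have "\<dots> \<le> (\<eta> s * B (\<eta> s)) / a + (B 1 + \<eta> s * B (\<eta> s))"
      using B.B_le_one_plus[OF nn, of s] by simp
    also have "\<dots> = B 1 + (1 / a + 1) * (\<eta> s * B (\<eta> s))"
      by (simp add: algebra_simps)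
    finally show "ennreal (B (\<eta> s)) * ennreal (real (nat \<lceil>\<eta> s / a\<rceil>)) \<le> ennreal (B 1) + ennreal (1 / a + 1) * ennreal (\<eta> s * B (\<eta> s))"
      using nn[of s] a by (simp add: ennreal_mult'[symmetric] ennreal_plus[symmetric] ennreal_leI del: ennreal_plus)
  qed
  also have "\<dots> = ennreal (B 1) + ennreal (1 / a + 1) * (\<integral>\<^sup>+s. ennreal (\<eta> s * B (\<eta> s)) \<partial>M)"
    by (subst nn_integral_add) (auto simp: M.emeasure_space_1 nn_integral_cmult)
  finally show ?thesis
    using fin by (auto simp: ennreal_mult_eq_top_iff top_unique less_top[symmetric])
qed

section \<open>Conditioning on the first n coordinates\<close>

text \<open>In \<open>comb_seq n w w'\<close> the path w supplies the first n coordinates and w' an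
  independent future. Thus \<open>cond\<close> bounds the conditional probability of T from below
  for every past in E, and integrating over the past gives the claim.\<close>

lemma emeasure_conditional_ge:
  assumes [measurable]: "E \<in> sets S" "T \<in> sets S"
    and dep: "\<And>w w'. w \<in> space S \<Longrightarrow> w' \<in> space S \<Longrightarrow> (\<And>k. k < n \<Longrightarrow> w k = w' k) \<Longrightarrow> w \<in> E \<longleftrightarrow> w' \<in> E"
    and cond: "\<And>w. w \<in> E \<Longrightarrow> \<delta> \<le> emeasure S {w' \<in> space S. comb_seq n w w' \<in> T}"
  shows "\<delta> * emeasure S E \<le> emeasure S (E \<inter> T)"
proof -
  have comb: "comb_seq n w w' \<in> space S" if "w \<in> space S" "w' \<in> space S" for w w'
    using that by (auto simp: space_PiM PiE_iff comb_seq_def)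
  have "\<delta> * emeasure S E = (\<integral>\<^sup>+w. \<delta> * indicator E w \<partial>S)"
    by (simp add: nn_integral_cmult_indicator)
  also have "\<dots> \<le> (\<integral>\<^sup>+w. \<integral>\<^sup>+w'. indicator (E \<inter> T) (comb_seq n w w') \<partial>S \<partial>S)"
  proof (rule nn_integral_mono)
    fix w assume w: "w \<in> space S"
    show "\<delta> * indicator E w \<le> (\<integral>\<^sup>+w'. indicator (E \<inter> T) (comb_seq n w w') \<partial>S)"
    proof (cases "w \<in> E")
      case True
      have "(\<integral>\<^sup>+w'. indicator (E \<inter> T) (comb_seq n w w') \<partial>S) = (\<integral>\<^sup>+w'. indicator {w' \<in> space S. comb_seq n w w' \<in> T} w' \<partial>S)"
      proof (rule nn_integral_cong)
        fix w' assume w': "w' \<in> space S"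
        have "comb_seq n w w' \<in> E"
          using dep[OF comb[OF w w'] w] True by (simp add: comb_seq_less)
        then show "indicator (E \<inter> T) (comb_seq n w w') = (indicator {w' \<in> space S. comb_seq n w w' \<in> T} w' :: ennreal)"
          using w' by (auto split: split_indicator)
      qed
      also have "\<dots> = emeasure S {w' \<in> space S. comb_seq n w w' \<in> T}"
        using w by (intro nn_integral_indicator) measurable
      finally show ?thesis
        using cond[OF True] True by simp
    qed simp
  qed
  also have "\<dots> = (\<integral>\<^sup>+w. indicator (E \<inter> T) w \<partial>S)"
    by (rule nn_integral_comb_seq[symmetric]) measurable
  finally show ?thesis by simp
qed

text \<open>The first n for which \<open>E n\<close> occurs splits the union into disjoint events
  that are still decided by the first n coordinates; the conditional bound applies to each, and the
  resulting parts of T are disjoint.\<close>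

lemma emeasure_first_passage:
  assumes E: "\<And>n. E n \<in> sets S" and T: "T \<in> sets S"
    and dep: "\<And>n w w'. w \<in> space S \<Longrightarrow> w' \<in> space S \<Longrightarrow> (\<And>k. k < n \<Longrightarrow> w k = w' k) \<Longrightarrow> w \<in> E n \<longleftrightarrow> w' \<in> E n"
    and cond: "\<And>n w. w \<in> E n \<Longrightarrow> \<delta> \<le> emeasure S {w' \<in> space S. comb_seq n w w' \<in> T}"
  shows "\<delta> * emeasure S (\<Union>n. E n) \<le> emeasure S T"
proof -
  define D where "D = disjointed E"
  have D: "D n \<in> sets S" for n
    using sets.range_disjointed_sets[of E S] E by (auto simp: D_def)
  have disj: "disjoint_family D"
    unfolding D_def by (rule disjoint_family_disjointed)
  have "\<delta> * emeasure S (\<Union>n. E n) = \<delta> * (\<Sum>n. emeasure S (D n))"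
    using D disj by (subst suminf_emeasure) (auto simp: D_def UN_disjointed_eq)
  also have "\<dots> = (\<Sum>n. \<delta> * emeasure S (D n))"
    by simp
  also have "\<dots> \<le> (\<Sum>n. emeasure S (D n \<inter> T))"
  proof (rule suminf_le)
    fix n
    show "\<delta> * emeasure S (D n) \<le> emeasure S (D n \<inter> T)"
    proof (rule emeasure_conditional_ge[where n=n])
      fix w w' assume w: "w \<in> space S" "w' \<in> space S" "\<And>k. k < n \<Longrightarrow> w k = w' k"
      have "w \<in> E i \<longleftrightarrow> w' \<in> E i" if "i \<le> n" for i
        using w that by (intro dep) auto
      then show "w \<in> D n \<longleftrightarrow> w' \<in> D n"
        by (auto simp: D_def disjointed_def)
    qed (use D T cond in \<open>auto simp: D_def disjointed_def\<close>)
  qed auto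
  also have "\<dots> = emeasure S (\<Union>n. D n \<inter> T)"
    using D T disj by (intro suminf_emeasure) (auto simp: disjoint_family_on_def)
  also have "\<dots> \<le> emeasure S T"
    using T by (intro emeasure_mono) auto
  finally show ?thesis .
qed

section \<open>Lifting a walk over a level by a single large perturbation\<close>

lemma integral_coordinate:
  fixes f :: "'a \<Rightarrow> real"
  assumes "f \<in> borel_measurable M"
  shows "(\<integral>w. f (w k) \<partial>S) = integral\<^sup>L M f"
proof -
  have "(\<integral>w. f (w k) \<partial>S) = integral\<^sup>L (distr S M (\<lambda>w. w k)) f"
    using assms by (intro integral_distr[symmetric]) auto
  then show ?thesis
    by (simp add: PiM_component)
qed

text \<open>Markov's inequality for the sum of the |X|, whose mean n e is at most half of (2 e + 1)
  n. The added 1 keeps the slope positive even when e = 0; at n = 0 the event is empty.\<close>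

lemma prob_walk_below_line:
  assumes X: "integrable M X"
  shows "measure S {w \<in> space S. walk X w n < - ((2 * (\<integral>s. \<bar>X s\<bar> \<partial>M) + 1) * real n)} \<le> 1 / 2"
proof (cases "n = 0")
  case False
  have [measurable]: "X \<in> borel_measurable M"
    using X by auto
  define e where "e = (\<integral>s. \<bar>X s\<bar> \<partial>M)"
  have e: "e \<ge> 0"
    unfolding e_def by (rule Bochner_Integration.integral_nonneg) simp
  define u where "u w = (\<Sum>k<n. \<bar>X (w k)\<bar>)" for w
  have iu: "integrable S u"
    unfolding u_def using X by (intro Bochner_Integration.integrable_sum integrable_abs integrable_coordinate)
  then have [measurable]: "u \<in> borel_measurable S"
    by auto
  have "integral\<^sup>L S u = (\<Sum>k<n. \<integral>w. \<bar>X (w k)\<bar> \<partial>S)"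
    unfolding u_def using X by (intro Bochner_Integration.integral_sum integrable_abs integrable_coordinate)
  also have "\<dots> = real n * e"
    by (subst integral_coordinate) (auto simp: e_def)
  finally have Iu: "integral\<^sup>L S u = real n * e" .
  have "measure S {w \<in> space S. walk X w n < - ((2 * e + 1) * real n)} \<le> measure S {w \<in> space S. u w \<ge> (2 * e + 1) * real n}"
  proof (rule P.finite_measure_mono)
    have "- walk X w n \<le> u w" for w
      unfolding walk_def u_def sum_negf[symmetric] by (intro sum_mono) auto
    then show "{w \<in> space S. walk X w n < - ((2 * e + 1) * real n)} \<subseteq> {w \<in> space S. u w \<ge> (2 * e + 1) * real n}"
      by (auto intro: order_trans) (smt (verit))
  qed measurable
  also have "\<dots> \<le> integral\<^sup>L S u / ((2 * e + 1) * real n)"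
    using False e
    by (intro integral_Markov_inequality_measure[OF iu sets.empty_sets]) (auto simp: u_def sum_nonneg)
  also have "\<dots> \<le> 1 / 2"
  proof -
    have "(2 * e + 1) * real n > 0"
      using False e by simp
    then show ?thesis
      unfolding Iu by (subst pos_divide_le_eq) (simp_all add: algebra_simps)
  qed
  finally show ?thesis by (simp add: e_def)
qed simp

text \<open>For levels above \<open>x0\<close> this makes the expected number of crossings of a line
  small; the 1 added to \<eta> absorbs the rounding up in that number.\<close>

lemma integral_tail_small:
  assumes eta: "integrable M \<eta>" and "\<And>s. \<eta> s \<ge> (0::real)" and e: "e > 0"
  obtains x0 where "x0 \<ge> 0" "(\<integral>\<^sup>+s. ennreal ((\<eta> s + 1) * indicator {x0<..} (\<eta> s)) \<partial>M) \<le> ennreal e"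
proof -
  have [measurable]: "\<eta> \<in> borel_measurable M"
    using eta by auto
  define f where "f n s = (\<eta> s + 1) * indicator {real n<..} (\<eta> s)" for n s
  have [measurable]: "f n \<in> borel_measurable M" for n
    unfolding f_def by measurable
  have fi: "integrable M (f n)" for n
  proof (rule Bochner_Integration.integrable_bound)
    show "integrable M (\<lambda>s. \<eta> s + 1)" using eta by auto
  qed (auto simp: f_def assms split: split_indicator)
  have "(\<lambda>n. integral\<^sup>L M (f n)) \<longlonglongrightarrow> (\<integral>s. 0 \<partial>M)"
  proof (rule integral_dominated_convergence[where w="\<lambda>s. \<eta> s + 1"])
    show "AE s in M. (\<lambda>n. f n s) \<longlonglongrightarrow> 0"
    proof (rule AE_I2)
      fix s
      obtain N :: nat where N: "\<eta> s \<le> real N"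
        using real_arch_simple by blast
      have "eventually (\<lambda>n. f n s = 0) sequentially"
        using N by (intro eventually_sequentiallyI[of N]) (auto simp: f_def split: split_indicator)
      then show "(\<lambda>n. f n s) \<longlonglongrightarrow> 0" by (rule tendsto_eventually)
    qed
  qed (use fi eta assms in \<open>auto simp: f_def split: split_indicator\<close>)
  then have "eventually (\<lambda>n. integral\<^sup>L M (f n) < e) sequentially"
    using e by (intro order_tendstoD) auto
  then obtain n where n: "integral\<^sup>L M (f n) < e"
    by (auto simp: eventually_sequentially)
  have "(\<integral>\<^sup>+s. ennreal (f n s) \<partial>M) = ennreal (integral\<^sup>L M (f n))"
    by (intro nn_integral_eq_integral fi AE_I2) (auto simp: f_def assms add_nonneg_nonneg)
  also have "\<dots> \<le> ennreal e"
    using n by (intro ennreal_leI) simp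
  finally show ?thesis
    by (intro that[of "real n"]) (auto simp: f_def)
qed

text \<open>A single large \<open>\<eta>\<close> lifts the walk over the level \<open>x\<close>; the events that time \<open>n\<close> is the
  first one with \<open>\<eta>\<close> above the line \<open>x + A n\<close> are disjoint.\<close>

lemma perturbed_walk_exceeds:
  assumes X: "integrable M X" and eta: "integrable M \<eta>" "\<And>s. \<eta> s \<ge> 0"
  obtains A x0 where "A > 0" "x0 \<ge> 0"
    "\<And>x. x \<ge> x0 \<Longrightarrow> ennreal (1 / 4) * (\<integral>\<^sup>+s. ennreal (max 0 ((\<eta> s - x) / A)) \<partial>M)
       \<le> emeasure S {w \<in> space S. \<exists>n. \<eta> (w n) > 0 \<and> walk X w n + \<eta> (w n) > x}"
proof -
  have [measurable]: "X \<in> borel_measurable M" "\<eta> \<in> borel_measurable M"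
    using X eta by auto
  define A where "A = 2 * (\<integral>s. \<bar>X s\<bar> \<partial>M) + 1"
  have A: "A \<ge> 1"
    unfolding A_def by (simp add: Bochner_Integration.integral_nonneg)
  obtain x0 where x0: "x0 \<ge> 0" "(\<integral>\<^sup>+s. ennreal ((\<eta> s + 1) * indicator {x0<..} (\<eta> s)) \<partial>M) \<le> ennreal (1 / 4)"
    using integral_tail_small[OF eta, of "1/4"] by auto
  show ?thesis
  proof (rule that[of A x0])
    fix x assume x: "x \<ge> x0"
    define Pn where "Pn n = {s \<in> space M. \<eta> s > x + A * real n}" for n
    have [measurable]: "Pn n \<in> sets M" for n
      unfolding Pn_def by measurable
    have sumP: "(\<Sum>n. emeasure M (Pn n)) = (\<integral>\<^sup>+s. ennreal (real (nat \<lceil>(\<eta> s - x) / A\<rceil>)) \<partial>M)"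
      unfolding Pn_def using A by (intro suminf_tail_eq) auto
    also have "\<dots> \<le> (\<integral>\<^sup>+s. ennreal ((\<eta> s + 1) * indicator {x0<..} (\<eta> s)) \<partial>M)"
    proof (intro nn_integral_mono ennreal_leI)
      fix s
      show "real (nat \<lceil>(\<eta> s - x) / A\<rceil>) \<le> (\<eta> s + 1) * indicator {x0<..} (\<eta> s)"
      proof (cases "\<eta> s > x")
        case True
        have "(\<eta> s - x) / A \<le> (\<eta> s - x) / 1"
          using True A by (intro divide_left_mono) auto
        moreover have "0 \<le> (\<eta> s - x) / A"
          using True A by simp
        then have "real (nat \<lceil>(\<eta> s - x) / A\<rceil>) \<le> (\<eta> s - x) / A + 1"
          by (rule real_nat_ceiling_le)
        ultimately have "real (nat \<lceil>(\<eta> s - x) / A\<rceil>) \<le> \<eta> s - x + 1"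
          by simp
        then show ?thesis
          using True x x0 by simp
      next
        case False
        then have "(\<eta> s - x) / A \<le> 0"
          using A by (simp add: divide_le_0_iff)
        then have "nat \<lceil>(\<eta> s - x) / A\<rceil> = 0"
          by simp
        then show ?thesis using eta(2)[of s] by simp
      qed
    qed
    also have "\<dots> \<le> ennreal (1 / 4)"
      by (rule x0)
    finally have sumP_le: "(\<Sum>n. emeasure M (Pn n)) \<le> ennreal (1 / 4)" .
    define L where "L n = {w \<in> space S. walk X w n < - (A * real n)}" for n
    define C where "C n = {w \<in> space S. w n \<in> Pn n}" for n
    \<comment> \<open>\<open>H n\<close> is decided by the coordinates before n: the walk is above
      its line at time n and no earlier perturbation has crossed. The second condition makes the
      events \<open>H n \<inter> C n\<close> disjoint.\<close>
    define H where "H n = space S - (L n \<union> (\<Union>k<n. C k))" for n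
    have [measurable]: "L n \<in> sets S" "C n \<in> sets S" for n
      unfolding L_def C_def by measurable
    have [measurable]: "H n \<in> sets S" for n
      unfolding H_def by measurable
    have C_eq: "emeasure S (C n) = emeasure M (Pn n)" for n
    proof -
      have "emeasure M (Pn n) = emeasure (distr S M (\<lambda>w. w n)) (Pn n)"
        by (simp add: PiM_component)
      also have "\<dots> = emeasure S (C n)"
        by (subst emeasure_distr) (auto simp: C_def intro!: arg_cong[where f="emeasure S"])
      finally show ?thesis ..
    qed
    \<comment> \<open>The constant is 1 - 1/2 - 1/4: at most 1/2 is lost to the walk below its line
      and at most 1/4, by the choice of \<open>x0\<close>, to all earlier crossings
      together.\<close>
    have H_ge: "emeasure S (H n) \<ge> ennreal (1 / 4)" for n
    proof -
      have "emeasure S (\<Union>k<n. C k) \<le> (\<Sum>k<n. emeasure S (C k))"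
        by (intro emeasure_subadditive_finite) auto
      also have "\<dots> \<le> (\<Sum>k. emeasure M (Pn k))"
        unfolding C_eq by (intro sum_le_suminf) auto
      also note sumP_le
      finally have "P.prob (\<Union>k<n. C k) \<le> 1 / 4"
        by (simp add: P.emeasure_eq_measure)
      moreover have "P.prob (L n) \<le> 1 / 2"
        unfolding L_def A_def by (rule prob_walk_below_line[OF X])
      moreover have "P.prob (L n \<union> (\<Union>k<n. C k)) \<le> P.prob (L n) + P.prob (\<Union>k<n. C k)"
        by (intro measure_subadditive) (auto simp: P.emeasure_eq_measure)
      moreover have "P.prob (H n) = 1 - P.prob (L n \<union> (\<Union>k<n. C k))"
        unfolding H_def by (intro P.prob_compl) measurable
      ultimately have "P.prob (H n) \<ge> 1 / 4" by simp
      then show ?thesis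
        by (simp add: P.emeasure_eq_measure)
    qed
    have G_ge: "emeasure M (Pn n) * ennreal (1 / 4) \<le> emeasure S (H n \<inter> C n)" for n
    proof -
      have "emeasure M (Pn n) * ennreal (1 / 4) \<le> emeasure M (Pn n) * emeasure S (H n)"
        by (intro mult_left_mono H_ge) auto
      also have "\<dots> \<le> emeasure S (H n \<inter> C n)"
      proof (rule emeasure_conditional_ge[where n=n])
        fix w w' assume w: "w \<in> space S" "w' \<in> space S" "\<And>k. k < n \<Longrightarrow> w k = w' k"
        then have "walk X w n = walk X w' n"
          by (simp add: walk_def)
        then show "w \<in> H n \<longleftrightarrow> w' \<in> H n"
          using w by (auto simp: H_def L_def C_def)
      next
        fix w assume "w \<in> H n"
        then have w: "w \<in> space S" by (simp add: H_def)
        have "{w' \<in> space S. comb_seq n w w' \<in> C n} = {w' \<in> space S. w' 0 \<in> Pn n}"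
          using w comb_seq_add[of n w _ 0] by (auto simp: C_def space_PiM PiE_iff comb_seq_def)
        also have "emeasure S \<dots> = emeasure (distr S M (\<lambda>w. w 0)) (Pn n)"
          by (subst emeasure_distr) (auto intro!: arg_cong[where f="emeasure S"])
        also have "\<dots> = emeasure M (Pn n)"
          by (simp add: PiM_component)
        finally show "emeasure M (Pn n) \<le> emeasure S {w' \<in> space S. comb_seq n w w' \<in> C n}"
          by simp
      qed measurable
      finally show ?thesis .
    qed
    have "disjoint_family (\<lambda>n. H n \<inter> C n)"
      unfolding disjoint_family_on_def
    proof (intro ballI impI)
      fix m n :: nat assume "m \<noteq> n"
      then have "m < n \<or> n < m" by auto
      then show "(H m \<inter> C m) \<inter> (H n \<inter> C n) = {}"
        by (auto simp: H_def)
    qed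
    then have UG: "(\<Sum>n. emeasure S (H n \<inter> C n)) = emeasure S (\<Union>n. H n \<inter> C n)"
      by (intro suminf_emeasure) auto
    have "ennreal (1 / 4) * (\<integral>\<^sup>+s. ennreal (max 0 ((\<eta> s - x) / A)) \<partial>M) \<le> ennreal (1 / 4) * (\<Sum>n. emeasure M (Pn n))"
      unfolding sumP using real_nat_ceiling_ge
      by (intro mult_left_mono nn_integral_mono ennreal_leI) auto
    also have "\<dots> = (\<Sum>n. emeasure M (Pn n) * ennreal (1 / 4))"
      by (simp add: mult.commute)
    also have "\<dots> \<le> (\<Sum>n. emeasure S (H n \<inter> C n))"
      by (intro suminf_le G_ge) auto
    also have "\<dots> = emeasure S (\<Union>n. H n \<inter> C n)"
      by (rule UG)
    also have "\<dots> \<le> emeasure S {w \<in> space S. \<exists>n. \<eta> (w n) > 0 \<and> walk X w n + \<eta> (w n) > x}"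
    proof (rule emeasure_mono)
      show "(\<Union>n. H n \<inter> C n) \<subseteq> {w \<in> space S. \<exists>n. \<eta> (w n) > 0 \<and> walk X w n + \<eta> (w n) > x}"
      proof
        fix w assume "w \<in> (\<Union>n. H n \<inter> C n)"
        then obtain n where n: "w \<in> H n" "w \<in> C n" by auto
        then have "walk X w n \<ge> - (A * real n)" "\<eta> (w n) > x + A * real n" "w \<in> space S"
          by (auto simp: H_def L_def C_def Pn_def)
        moreover have "A * real n \<ge> 0" using A by simp
        ultimately have "\<eta> (w n) > 0 \<and> walk X w n + \<eta> (w n) > x"
          using x x0 by linarith
        then show "w \<in> {w \<in> space S. \<exists>n. \<eta> (w n) > 0 \<and> walk X w n + \<eta> (w n) > x}"
          using \<open>w \<in> space S\<close> by blast
      qed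
    qed measurable
    finally show "ennreal (1 / 4) * (\<integral>\<^sup>+s. ennreal (max 0 ((\<eta> s - x) / A)) \<partial>M)
       \<le> emeasure S {w \<in> space S. \<exists>n. \<eta> (w n) > 0 \<and> walk X w n + \<eta> (w n) > x}" .
  qed (use A x0 in auto)
qed

end

subsection \<open>Perpetuities on the sequence space\<close>

lemma log_plus_nonneg [simp]: "log_plus x \<ge> 0"
  by (simp add: log_plus_def)

lemma log_plus_le_iff:
  assumes "c \<ge> 0"
  shows "log_plus x \<le> c \<longleftrightarrow> x \<le> exp c"
proof (cases "x \<le> 0")
  case True
  then show ?thesis
    using assms exp_gt_zero[of c] by (simp add: log_plus_def del: exp_gt_zero)
next
  case False
  then have "ln x \<le> c \<longleftrightarrow> x \<le> exp c"
    using exp_le_cancel_iff[of "ln x" c] by simp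
  then show ?thesis
    using False assms by (simp add: log_plus_def)
qed

lemma log_plus_abs_eq: "log_plus \<bar>x\<bar> = max 0 (ln \<bar>x\<bar>)"
  by (simp add: log_plus_def max.commute)

lemma le_exp_log_plus: "x \<le> exp (log_plus x)"
  using log_plus_le_iff[of "log_plus x" x] by simp

lemma measurable_log_plus [measurable]: "log_plus \<in> borel_measurable borel"
  unfolding log_plus_def by measurable

lemma (in moderate_growth) B_add3_le:
  assumes "x \<ge> 0" "y \<ge> 0" "z \<ge> 0"
  shows "B (x + y + z) \<le> 4 ^ p * (B x + B y + B z)"
proof -
  have "B (x + y + z) \<le> 2 ^ p * (B (x + y) + B z)"
    using assms by (intro B_add_le) auto
  also have "\<dots> \<le> 2 ^ p * (2 ^ p * (B x + B y) + 2 ^ p * B z)"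
    using assms mult_right_mono[of 1 "2 ^ p" "B z"] by (intro mult_left_mono add_mono B_add_le) auto
  also have "\<dots> = (2 ^ p * 2 ^ p) * (B x + B y + B z)"
    by (simp add: algebra_simps)
  also have "(2::real) ^ p * 2 ^ p = 4 ^ p"
    by (simp add: power_mult_distrib[symmetric])
  finally show ?thesis .
qed

text \<open>N is the law of one pair. \<open>AE_fst_nonzero\<close> is a separate assumption because
  \<open>ln 0\<close> is an ordinary real number in HOL, so integrability of the logarithm does not
  exclude zeros.\<close>

locale perpetuity_space = sequence_space N for N :: "(real \<times> real) measure" +
  assumes sets_N: "sets N = sets borel"
    and AE_fst_nonzero: "AE s in N. fst s \<noteq> 0"
    and integrable_ln_fst: "integrable N (\<lambda>s. ln \<bar>fst s\<bar>)"
    and ln_fst_neg: "(\<integral>s. ln \<bar>fst s\<bar> \<partial>N) < 0"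
    and integrable_log_plus_snd: "integrable N (\<lambda>s. log_plus \<bar>snd s\<bar>)"
begin

lemma sets_N_pair [measurable_cong]: "sets N = sets (borel \<Otimes>\<^sub>M borel)"
  unfolding borel_prod by (rule sets_N)

definition partial_prod :: "(nat \<Rightarrow> real \<times> real) \<Rightarrow> nat \<Rightarrow> real" where
  "partial_prod w n = (\<Prod>k<n. fst (w k))"

definition summand :: "(nat \<Rightarrow> real \<times> real) \<Rightarrow> nat \<Rightarrow> real" where
  "summand w n = partial_prod w n * snd (w n)"

definition partial_sum :: "(nat \<Rightarrow> real \<times> real) \<Rightarrow> nat \<Rightarrow> real" where
  "partial_sum w n = (\<Sum>k<n. summand w k)"

definition Z :: "(nat \<Rightarrow> real \<times> real) \<Rightarrow> real" where
  "Z w = (\<Sum>k. summand w k)"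

lemma measurable_partial_prod [measurable]: "(\<lambda>w. partial_prod w n) \<in> borel_measurable S"
  unfolding partial_prod_def by measurable

lemma measurable_summand [measurable]: "(\<lambda>w. summand w n) \<in> borel_measurable S"
  unfolding summand_def by measurable

lemma measurable_partial_sum [measurable]: "(\<lambda>w. partial_sum w n) \<in> borel_measurable S"
  unfolding partial_sum_def by measurable

lemma measurable_Z [measurable]: "Z \<in> borel_measurable S"
  unfolding Z_def by measurable

lemma abs_partial_prod_le: "\<bar>partial_prod w n\<bar> \<le> exp (walk (\<lambda>s. ln \<bar>fst s\<bar>) w n)"
proof -
  have "\<bar>fst (w k)\<bar> \<le> exp (ln \<bar>fst (w k)\<bar>)" for k
    by (cases "fst (w k) = 0") auto
  then have "(\<Prod>k<n. \<bar>fst (w k)\<bar>) \<le> (\<Prod>k<n. exp (ln \<bar>fst (w k)\<bar>))"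
    by (intro prod_mono) auto
  then show ?thesis
    by (simp add: partial_prod_def abs_prod walk_def exp_sum)
qed

text \<open>The mean -3 \<open>drift\<close> of log |M| is split in three: two units are added to
  the walk, whose mean stays negative. Of these two, one is spent on making log+ |Q| minus a line
  bounded, and the other survives as the geometric factor exp (-\<open>drift\<close>) ^ n of the
  summands.\<close>

definition drift :: real where
  "drift = - (\<integral>s. ln \<bar>fst s\<bar> \<partial>N) / 3"

lemma drift_pos: "drift > 0"
  using ln_fst_neg by (simp add: drift_def)

definition lifted_step :: "real \<times> real \<Rightarrow> real" where
  "lifted_step s = ln \<bar>fst s\<bar> + 2 * drift"

lemma lifted_step: "integrable N lifted_step" "integral\<^sup>L N lifted_step < 0"
  using integrable_ln_fst ln_fst_neg
  by (auto simp: lifted_step_def[abs_def] M.prob_space drift_def)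

lemma walk_lifted_step: "walk lifted_step w n = walk (\<lambda>s. ln \<bar>fst s\<bar>) w n + 2 * drift * real n"
  by (simp add: walk_def lifted_step_def sum.distrib)

definition walk_sup :: "(nat \<Rightarrow> real \<times> real) \<Rightarrow> real" where
  "walk_sup w = (SUP n. walk lifted_step w n)"

definition snd_sup :: "(nat \<Rightarrow> real \<times> real) \<Rightarrow> real" where
  "snd_sup w = (SUP n. log_plus \<bar>snd (w n)\<bar> - drift * real n)"

text \<open>A condition on single paths under which absolute convergence and the bound on Z are
  deterministic statements.\<close>

definition regular_path :: "(nat \<Rightarrow> real \<times> real) \<Rightarrow> bool" where
  "regular_path w \<longleftrightarrow> bdd_above (range (walk lifted_step w)) \<and>
     bdd_above (range (\<lambda>n. log_plus \<bar>snd (w n)\<bar> - drift * real n))"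

lemma AE_regular_path: "AE w in S. regular_path w"
  using AE_walk_bounded[OF lifted_step] AE_subtract_drift_bounded[OF integrable_log_plus_snd log_plus_nonneg drift_pos]
  by eventually_elim (auto simp: regular_path_def)

lemma sup_nonneg:
  assumes "regular_path w"
  shows "walk_sup w \<ge> 0" "snd_sup w \<ge> 0"
proof -
  have "walk lifted_step w 0 \<le> walk_sup w"
    unfolding walk_sup_def using assms by (intro cSUP_upper) (auto simp: regular_path_def)
  then show "walk_sup w \<ge> 0" by simp
  have "log_plus \<bar>snd (w 0)\<bar> - drift * real 0 \<le> snd_sup w"
    unfolding snd_sup_def using assms by (intro cSUP_upper) (auto simp: regular_path_def)
  then show "snd_sup w \<ge> 0"
    using log_plus_nonneg[of "\<bar>snd (w 0)\<bar>"] by linarith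
qed

lemma abs_summand_le:
  assumes "regular_path w"
  shows "\<bar>summand w n\<bar> \<le> exp (walk_sup w + snd_sup w) * exp (- drift) ^ n"
proof -
  have "walk lifted_step w n \<le> walk_sup w"
    unfolding walk_sup_def using assms by (intro cSUP_upper) (auto simp: regular_path_def)
  moreover have "log_plus \<bar>snd (w n)\<bar> - drift * real n \<le> snd_sup w"
    unfolding snd_sup_def using assms by (intro cSUP_upper) (auto simp: regular_path_def)
  ultimately have le: "walk (\<lambda>s. ln \<bar>fst s\<bar>) w n + log_plus \<bar>snd (w n)\<bar> \<le> walk_sup w + snd_sup w + real n * (- drift)"
    by (simp add: walk_lifted_step algebra_simps)
  have "\<bar>summand w n\<bar> \<le> exp (walk (\<lambda>s. ln \<bar>fst s\<bar>) w n) * exp (log_plus \<bar>snd (w n)\<bar>)"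
    unfolding summand_def abs_mult by (intro mult_mono abs_partial_prod_le le_exp_log_plus) auto
  also have "\<dots> \<le> exp (walk_sup w + snd_sup w + real n * (- drift))"
    using le by (simp add: exp_add[symmetric])
  also have "\<dots> = exp (walk_sup w + snd_sup w) * exp (- drift) ^ n"
    by (simp only: exp_add exp_of_nat_mult)
  finally show ?thesis .
qed

lemma exp_drift_less_1: "exp (- drift) < 1"
  using drift_pos by simp

lemma summable_abs_summand:
  assumes "regular_path w"
  shows "summable (\<lambda>n. \<bar>summand w n\<bar>)"
proof (rule summable_comparison_test)
  show "\<exists>N. \<forall>n\<ge>N. norm \<bar>summand w n\<bar> \<le> exp (walk_sup w + snd_sup w) * exp (- drift) ^ n"
    using abs_summand_le[OF assms] by auto
  show "summable (\<lambda>n. exp (walk_sup w + snd_sup w) * exp (- drift) ^ n)"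
    using exp_drift_less_1 by (intro summable_mult summable_geometric) auto
qed

text \<open>The geometric majorant is summed before taking logarithms, and the additive constant is
  the logarithm of 1 / (1 - exp (-\<open>drift\<close>)). Both suprema are nonnegative, so the bound
  also dominates the value 0 at which log+ is cut off.\<close>

lemma log_plus_Z_le:
  assumes "regular_path w"
  shows "log_plus \<bar>Z w\<bar> \<le> walk_sup w + snd_sup w + (- ln (1 - exp (- drift)))"
proof -
  have q: "0 < 1 - exp (- drift)" "1 - exp (- drift) \<le> 1"
    using exp_drift_less_1 by auto
  have "\<bar>Z w\<bar> \<le> (\<Sum>n. \<bar>summand w n\<bar>)"
    unfolding Z_def by (rule summable_rabs[OF summable_abs_summand[OF assms]])
  also have "\<dots> \<le> (\<Sum>n. exp (walk_sup w + snd_sup w) * exp (- drift) ^ n)"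
    using exp_drift_less_1
    by (intro suminf_le abs_summand_le assms summable_abs_summand summable_mult summable_geometric) auto
  also have "\<dots> = exp (walk_sup w + snd_sup w) * (1 / (1 - exp (- drift)))"
    using exp_drift_less_1 by (subst suminf_mult) (auto simp: suminf_geometric intro!: summable_geometric)
  also have "\<dots> = exp (walk_sup w + snd_sup w + (- ln (1 - exp (- drift))))"
    using q by (simp add: exp_add[of "walk_sup w + snd_sup w"] exp_minus exp_ln divide_inverse del: add_uminus_conv_diff)
  finally show ?thesis
    using sup_nonneg[OF assms] ln_le_zero_iff[OF q(1)] q(2) by (subst log_plus_le_iff) linarith+
qed

lemma perpetuity_moment:
  assumes B: "moderate_growth B p"
    and fin1: "(\<integral>\<^sup>+s. ennreal (log_plus \<bar>fst s\<bar> * B (log_plus \<bar>fst s\<bar>)) \<partial>N) < \<infinity>"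
    and fin2: "(\<integral>\<^sup>+s. ennreal (log_plus \<bar>snd s\<bar> * B (log_plus \<bar>snd s\<bar>)) \<partial>N) < \<infinity>"
  shows "(\<integral>\<^sup>+w. ennreal (B (log_plus \<bar>Z w\<bar>)) \<partial>S) < \<infinity>"
proof -
  interpret B: moderate_growth B p by fact
  note [measurable] = B.measurable_B
  have [measurable]: "lifted_step \<in> borel_measurable N"
    using lifted_step by auto
  have i1: "integrable N (\<lambda>s. log_plus \<bar>fst s\<bar> * B (log_plus \<bar>fst s\<bar>))"
    using fin1 by (intro integrableI_nonneg AE_I2) auto
  \<comment> \<open>The positive part of the lifted step is at most log+ |M| + 2
    \<open>drift\<close>, and x B x is subadditive up to the factor 2 ^ (p + 1), so the shift does
    not affect the moment.\<close>
  have iX: "integrable N (\<lambda>s. max 0 (lifted_step s) * B (max 0 (lifted_step s)))"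
  proof (rule Bochner_Integration.integrable_bound)
    let ?a = "2 * drift"
    show "integrable N (\<lambda>s. 2 ^ Suc p * (log_plus \<bar>fst s\<bar> * B (log_plus \<bar>fst s\<bar>) + ?a * B ?a))"
      using i1 by (intro integrable_mult_right Bochner_Integration.integrable_add M.integrable_const)
    show "AE s in N. norm (max 0 (lifted_step s) * B (max 0 (lifted_step s)))
      \<le> norm (2 ^ Suc p * (log_plus \<bar>fst s\<bar> * B (log_plus \<bar>fst s\<bar>) + ?a * B ?a))"
    proof (rule AE_I2)
      fix s
      have "max 0 (lifted_step s) * B (max 0 (lifted_step s)) \<le> (log_plus \<bar>fst s\<bar> + ?a) * B (log_plus \<bar>fst s\<bar> + ?a)"
        using drift_pos by (intro B.times_B_mono) (auto simp: lifted_step_def log_plus_abs_eq)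
      also have "\<dots> \<le> 2 ^ Suc p * (log_plus \<bar>fst s\<bar> * B (log_plus \<bar>fst s\<bar>) + ?a * B ?a)"
        using drift_pos by (intro B.times_B_add_le) auto
      finally show "norm (max 0 (lifted_step s) * B (max 0 (lifted_step s)))
        \<le> norm (2 ^ Suc p * (log_plus \<bar>fst s\<bar> * B (log_plus \<bar>fst s\<bar>) + ?a * B ?a))"
        by simp
    qed
  qed measurable
  define F1 where "F1 w = (SUP n. ennreal (B (walk lifted_step w n)))" for w
  define F2 where "F2 (w :: nat \<Rightarrow> real \<times> real) = (SUP n. ennreal (B (max 0 (log_plus \<bar>snd (w n)\<bar> - drift * real n))))" for w
  have [measurable]: "F1 \<in> borel_measurable S" "F2 \<in> borel_measurable S"
    unfolding F1_def F2_def by measurable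
  have F1: "(\<integral>\<^sup>+w. F1 w \<partial>S) < \<infinity>"
    unfolding F1_def by (rule walk_sup_moment[OF B lifted_step iX])
  have F2: "(\<integral>\<^sup>+w. F2 w \<partial>S) < \<infinity>"
    unfolding F2_def
    using subtract_drift_sup_moment[OF B drift_pos _ _ fin2] by simp
  define c where "c = - ln (1 - exp (- drift))"
  have c: "c \<ge> 0"
    using exp_drift_less_1 by (simp add: c_def)
  define K where "K = ennreal (4 ^ p)"
  define L where "L = ennreal (2 ^ p)"
  have "AE w in S. ennreal (B (log_plus \<bar>Z w\<bar>)) \<le> K * (L * F1 w + L * F2 w + ennreal (B c))"
    using AE_regular_path
  proof eventually_elim
    case (elim w)
    have "B (log_plus \<bar>Z w\<bar>) \<le> B (walk_sup w + snd_sup w + c)"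
      unfolding c_def by (intro B.B_mono log_plus_Z_le elim)
    also have "\<dots> \<le> 4 ^ p * (B (walk_sup w) + B (snd_sup w) + B c)"
      by (intro B.B_add3_le sup_nonneg elim c)
    finally have "ennreal (B (log_plus \<bar>Z w\<bar>)) \<le> K * (ennreal (B (walk_sup w)) + ennreal (B (snd_sup w)) + ennreal (B c))"
      by (simp add: K_def ennreal_mult'[symmetric] ennreal_plus[symmetric] ennreal_leI del: ennreal_plus ennreal_power)
    also have "\<dots> \<le> K * (L * F1 w + L * F2 w + ennreal (B c))"
    proof (intro mult_left_mono add_mono order_refl)
      show "ennreal (B (walk_sup w)) \<le> L * F1 w"
        unfolding walk_sup_def F1_def L_def using elim
        by (intro B.B_SUP_le[of _ 0]) (auto simp: regular_path_def)
      have "ennreal (B (snd_sup w)) \<le> L * (SUP n. ennreal (B (log_plus \<bar>snd (w n)\<bar> - drift * real n)))"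
        unfolding snd_sup_def L_def using elim
        by (intro B.B_SUP_le[of _ 0]) (auto simp: regular_path_def)
      also have "\<dots> \<le> L * F2 w"
        unfolding F2_def by (intro mult_left_mono SUP_mono' ennreal_leI B.B_mono) auto
      finally show "ennreal (B (snd_sup w)) \<le> L * F2 w" .
    qed auto
    finally show ?case .
  qed
  then have "(\<integral>\<^sup>+w. ennreal (B (log_plus \<bar>Z w\<bar>)) \<partial>S) \<le> (\<integral>\<^sup>+w. K * (L * F1 w + L * F2 w + ennreal (B c)) \<partial>S)"
    by (rule nn_integral_mono_AE)
  also have "\<dots> = K * (L * (\<integral>\<^sup>+w. F1 w \<partial>S) + L * (\<integral>\<^sup>+w. F2 w \<partial>S) + ennreal (B c))"
    by (simp add: nn_integral_cmult nn_integral_add P.emeasure_space_1)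
  also have "\<dots> < \<infinity>"
    using F1 F2 by (auto simp: K_def L_def ennreal_mult_less_top simp del: ennreal_power)
  finally show ?thesis .
qed

end

text \<open>Summing a tail bound against the increments of \<open>B\<close> at the integers: on the left this yields
  the moment of \<open>\<eta> B(\<eta>)\<close>, since \<open>(\<eta> - j)\<^sup>+ \<ge> \<eta>/2\<close> for \<open>j \<le> \<eta>/2\<close>.\<close>

lemma (in moderate_growth) tail_sum_moment:
  assumes [measurable]: "\<eta> \<in> borel_measurable M1" "Y \<in> borel_measurable M2"
    and eta: "\<And>s. \<eta> s \<ge> 0" "(\<integral>\<^sup>+s. ennreal (\<eta> s) \<partial>M1) < \<infinity>"
    and Y: "\<And>w. Y w \<ge> 0" "(\<integral>\<^sup>+w. ennreal (B (Y w)) \<partial>M2) < \<infinity>" "prob_space M2"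
    and A: "A > 0" and c: "c \<ge> 0"
    and tail: "\<And>x. x \<ge> x0 \<Longrightarrow> (\<integral>\<^sup>+s. ennreal (max 0 ((\<eta> s - x) / A)) \<partial>M1) \<le> ennreal K * emeasure M2 {w \<in> space M2. Y w > x - c}"
  shows "(\<integral>\<^sup>+s. ennreal (\<eta> s * B (\<eta> s)) \<partial>M1) < \<infinity>"
proof -
  interpret Y: prob_space M2 by fact
  \<comment> \<open>The tail bound holds only from \<open>x0\<close> on, so the increments of B
    start at an integer J beyond it.\<close>
  obtain J :: nat where J: "x0 \<le> real J"
    using real_arch_simple by blast
  define D where "D j = B (real (J + Suc j)) - B (real (J + j))" for j
  have D: "D j \<ge> 0" for j
    unfolding D_def by (simp add: B_mono)
  have sumD: "(\<Sum>j<n. D j) = B (real (J + n)) - B (real J)" for n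
    unfolding D_def by (subst sum_lessThan_telescope) simp
  have up: "(\<Sum>j. ennreal (D j) * indicator {real (J + j) - c<..} y) \<le> ennreal (B (y + c + 1))" for y
  proof -
    \<comment> \<open>Cutting the argument at y + c + 1 leaves the increment \<open>D j\<close>
      intact whenever J + j < y + c and makes it nonnegative otherwise. The sum then telescopes to
      at most the final value; the 1 is the overshoot of the last integer step.\<close>
    define g where "g i = B (min (real (J + i)) (y + c + 1))" for i
    have "(\<Sum>j<n. ennreal (D j) * indicator {real (J + j) - c<..} y) \<le> ennreal (B (y + c + 1))" for n
    proof -
      have "D j * indicator {real (J + j) - c<..} y \<le> g (Suc j) - g j" for j
      proof (cases "real (J + j) - c < y")
        case True
        then have "min (real (J + Suc j)) (y + c + 1) = real (J + Suc j)" "min (real (J + j)) (y + c + 1) = real (J + j)"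
          by auto
        then show ?thesis using True by (simp add: g_def D_def)
      next
        case False
        then show ?thesis by (simp add: g_def B_mono min.coboundedI1)
      qed
      then have "(\<Sum>j<n. D j * indicator {real (J + j) - c<..} y) \<le> (\<Sum>j<n. g (Suc j) - g j)"
        by (intro sum_mono)
      also have "\<dots> = g n - g 0"
        by (rule sum_lessThan_telescope)
      also have "\<dots> \<le> g n"
        by (simp add: g_def)
      also have "\<dots> \<le> B (y + c + 1)"
        by (simp add: g_def B_mono)
      finally have le: "(\<Sum>j<n. D j * indicator {real (J + j) - c<..} y) \<le> B (y + c + 1)" .
      have "(\<Sum>j<n. ennreal (D j) * indicator {real (J + j) - c<..} y) = (\<Sum>j<n. ennreal (D j * indicator {real (J + j) - c<..} y))"
        by (intro sum.cong) (auto split: split_indicator)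
      also have "\<dots> = ennreal (\<Sum>j<n. D j * indicator {real (J + j) - c<..} y)"
        using D by (intro sum_ennreal) auto
      finally show ?thesis
        using le by (simp add: ennreal_leI)
    qed
    then show ?thesis
      unfolding suminf_eq_SUP by (intro SUP_least)
  qed
  have low: "ennreal (\<eta> s / (2 * A) * (B (\<eta> s / 2) - B (real J))) \<le> (\<Sum>j. ennreal (D j) * ennreal (max 0 ((\<eta> s - real (J + j)) / A)))" for s
  proof -
    \<comment> \<open>Natural subtraction gives n = 0 when \<eta> / 2 lies below J; the left-hand
      side is then at most 0 and the sum empty. Otherwise J + n is the first integer at or above
      \<eta> / 2.\<close>
    define n where "n = nat \<lceil>\<eta> s / 2\<rceil> - J"
    have n1: "\<eta> s / 2 \<le> real (J + n)"
      unfolding n_def by linarith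
    have n2: "real (J + j) \<le> \<eta> s / 2" if "j < n" for j
    proof -
      have "J + j < nat \<lceil>\<eta> s / 2\<rceil>" using that unfolding n_def by linarith
      then show ?thesis by linarith
    qed
    have "\<eta> s / (2 * A) * (B (\<eta> s / 2) - B (real J)) \<le> \<eta> s / (2 * A) * (\<Sum>j<n. D j)"
      unfolding sumD using eta(1)[of s] A n1 by (intro mult_left_mono diff_right_mono B_mono) auto
    also have "\<dots> = (\<Sum>j<n. D j * (\<eta> s / (2 * A)))"
      by (subst mult.commute) (rule sum_distrib_right)
    also have "\<dots> \<le> (\<Sum>j<n. D j * max 0 ((\<eta> s - real (J + j)) / A))"
    proof (intro sum_mono mult_left_mono D)
      fix j assume "j \<in> {..<n}"
      then have "(\<eta> s / 2) / A \<le> (\<eta> s - real (J + j)) / A"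
        using n2[of j] A by (intro divide_right_mono) auto
      then show "\<eta> s / (2 * A) \<le> max 0 ((\<eta> s - real (J + j)) / A)"
        by simp
    qed
    finally have "ennreal (\<eta> s / (2 * A) * (B (\<eta> s / 2) - B (real J))) \<le> ennreal (\<Sum>j<n. D j * max 0 ((\<eta> s - real (J + j)) / A))"
      by (rule ennreal_leI)
    also have "\<dots> = (\<Sum>j<n. ennreal (D j) * ennreal (max 0 ((\<eta> s - real (J + j)) / A)))"
      using D by (subst sum_ennreal[symmetric]) (auto simp: ennreal_mult')
    also have "\<dots> \<le> (\<Sum>j. ennreal (D j) * ennreal (max 0 ((\<eta> s - real (J + j)) / A)))"
      by (intro sum_le_suminf) auto
    finally show ?thesis .
  qed
  have fin: "(\<integral>\<^sup>+s. ennreal (\<eta> s / (2 * A) * (B (\<eta> s / 2) - B (real J))) \<partial>M1) < \<infinity>"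
  proof -
    have "(\<integral>\<^sup>+s. ennreal (\<eta> s / (2 * A) * (B (\<eta> s / 2) - B (real J))) \<partial>M1)
      \<le> (\<integral>\<^sup>+s. (\<Sum>j. ennreal (D j) * ennreal (max 0 ((\<eta> s - real (J + j)) / A))) \<partial>M1)"
      by (intro nn_integral_mono low)
    also have "\<dots> = (\<Sum>j. \<integral>\<^sup>+s. ennreal (D j) * ennreal (max 0 ((\<eta> s - real (J + j)) / A)) \<partial>M1)"
      by (rule nn_integral_suminf) measurable
    also have "\<dots> = (\<Sum>j. ennreal (D j) * (\<integral>\<^sup>+s. ennreal (max 0 ((\<eta> s - real (J + j)) / A)) \<partial>M1))"
      by (subst nn_integral_cmult) auto
    also have "\<dots> \<le> (\<Sum>j. ennreal (D j) * (ennreal K * emeasure M2 {w \<in> space M2. Y w > real (J + j) - c}))"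
      using J by (intro suminf_le mult_left_mono tail) auto
    also have "\<dots> = (\<Sum>j. ennreal K * (\<integral>\<^sup>+w. ennreal (D j) * indicator {real (J + j) - c<..} (Y w) \<partial>M2))"
    proof (rule suminf_cong)
      fix j
      have "(\<integral>\<^sup>+w. indicator {real (J + j) - c<..} (Y w) \<partial>M2) = (\<integral>\<^sup>+w. indicator {w \<in> space M2. Y w > real (J + j) - c} w \<partial>M2)"
        by (intro nn_integral_cong) (auto split: split_indicator)
      then have "emeasure M2 {w \<in> space M2. Y w > real (J + j) - c} = (\<integral>\<^sup>+w. indicator {real (J + j) - c<..} (Y w) \<partial>M2)"
        by simp
      then show "ennreal (D j) * (ennreal K * emeasure M2 {w \<in> space M2. Y w > real (J + j) - c})
        = ennreal K * (\<integral>\<^sup>+w. ennreal (D j) * indicator {real (J + j) - c<..} (Y w) \<partial>M2)"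
        by (subst nn_integral_cmult) (auto simp: mult.left_commute)
    qed
    also have "\<dots> = ennreal K * (\<Sum>j. \<integral>\<^sup>+w. ennreal (D j) * indicator {real (J + j) - c<..} (Y w) \<partial>M2)"
      by (rule ennreal_suminf_cmult)
    also have "(\<Sum>j. \<integral>\<^sup>+w. ennreal (D j) * indicator {real (J + j) - c<..} (Y w) \<partial>M2)
      = (\<integral>\<^sup>+w. (\<Sum>j. ennreal (D j) * indicator {real (J + j) - c<..} (Y w)) \<partial>M2)"
      by (rule nn_integral_suminf[symmetric]) measurable
    also have "\<dots> \<le> (\<integral>\<^sup>+w. ennreal (B (Y w + c + 1)) \<partial>M2)"
      by (intro nn_integral_mono up)
    also have "\<dots> \<le> (\<integral>\<^sup>+w. ennreal (2 ^ p) * (ennreal (B (Y w)) + ennreal (B (c + 1))) \<partial>M2)"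
    proof (rule nn_integral_mono)
      fix w
      show "ennreal (B (Y w + c + 1)) \<le> ennreal (2 ^ p) * (ennreal (B (Y w)) + ennreal (B (c + 1)))"
        using B_add_le[of "Y w" "c + 1"] Y(1)[of w] c
        by (simp add: add.assoc ennreal_mult'[symmetric] ennreal_plus[symmetric] ennreal_leI del: ennreal_plus ennreal_power)
    qed
    also have "\<dots> = ennreal (2 ^ p) * ((\<integral>\<^sup>+w. ennreal (B (Y w)) \<partial>M2) + ennreal (B (c + 1)))"
      by (simp add: nn_integral_cmult nn_integral_add Y.emeasure_space_1)
    finally show ?thesis
      using Y(2) by (auto simp: ennreal_mult_eq_top_iff top_unique less_top[symmetric] mult_left_mono simp del: ennreal_power)
  qed
  \<comment> \<open>Halving the argument of B costs the factor 2 ^ p. The increments only recover B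
    (\<eta> / 2) - B J, and the missing B J is paid for by the finite mean of \<eta>.\<close>
  have "(\<integral>\<^sup>+s. ennreal (\<eta> s * B (\<eta> s)) \<partial>M1) \<le>
    (\<integral>\<^sup>+s. ennreal (2 ^ p * (2 * A)) * ennreal (\<eta> s / (2 * A) * (B (\<eta> s / 2) - B (real J))) + ennreal (2 ^ p * B (real J)) * ennreal (\<eta> s) \<partial>M1)"
  proof (rule nn_integral_mono)
    fix s
    have "\<eta> s * B (\<eta> s) \<le> \<eta> s * (2 ^ p * B (\<eta> s / 2))"
      using B_double[of "\<eta> s / 2"] eta(1)[of s] by (intro mult_left_mono) auto
    also have "\<dots> = (2 ^ p * (2 * A)) * (\<eta> s / (2 * A) * (B (\<eta> s / 2) - B (real J))) + (2 ^ p * B (real J)) * \<eta> s"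
      using A by (simp add: field_simps)
    finally have "ennreal (\<eta> s * B (\<eta> s)) \<le> ennreal ((2 ^ p * (2 * A)) * (\<eta> s / (2 * A) * (B (\<eta> s / 2) - B (real J))) + (2 ^ p * B (real J)) * \<eta> s)"
      by (rule ennreal_leI)
    also have "\<dots> \<le> ennreal ((2 ^ p * (2 * A)) * (\<eta> s / (2 * A) * (B (\<eta> s / 2) - B (real J)))) + ennreal ((2 ^ p * B (real J)) * \<eta> s)"
      by (cases "(2 ^ p * (2 * A)) * (\<eta> s / (2 * A) * (B (\<eta> s / 2) - B (real J))) \<ge> 0")
        (use eta(1)[of s] in \<open>auto simp: ennreal_neg intro!: add_increasing ennreal_leI\<close>)
    also have "\<dots> = ennreal (2 ^ p * (2 * A)) * ennreal (\<eta> s / (2 * A) * (B (\<eta> s / 2) - B (real J))) + ennreal (2 ^ p * B (real J)) * ennreal (\<eta> s)"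
      using A by (subst (1 2) ennreal_mult') auto
    finally show "ennreal (\<eta> s * B (\<eta> s)) \<le> ennreal (2 ^ p * (2 * A)) * ennreal (\<eta> s / (2 * A) * (B (\<eta> s / 2) - B (real J))) + ennreal (2 ^ p * B (real J)) * ennreal (\<eta> s)" .
  qed
  also have "\<dots> = ennreal (2 ^ p * (2 * A)) * (\<integral>\<^sup>+s. ennreal (\<eta> s / (2 * A) * (B (\<eta> s / 2) - B (real J))) \<partial>M1) + ennreal (2 ^ p * B (real J)) * (\<integral>\<^sup>+s. ennreal (\<eta> s) \<partial>M1)"
    by (subst nn_integral_add) (auto simp: nn_integral_cmult)
  also have "\<dots> < \<infinity>"
    using fin eta(2) by (auto simp: ennreal_mult_less_top)
  finally show ?thesis .
qed

section \<open>Affine images of a non-degenerate variable\<close>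

text \<open>A non-constant variable has mass strictly on both sides of its mean. Z may have no mean,
  so the bounded variable arctan Z is used and the cut is carried back by tan; continuity from below
  then opens a gap above the cut.\<close>

lemma (in prob_space) nonconst_two_values:
  fixes Z :: "'a \<Rightarrow> real"
  assumes [measurable]: "Z \<in> borel_measurable M" and nonconst: "\<not> (\<exists>z. AE w in M. Z w = z)"
  obtains a b where "a < b" "prob {w \<in> space M. Z w < a} > 0" "prob {w \<in> space M. Z w > b} > 0"
proof -
  define \<mu> where "\<mu> = expectation (\<lambda>w. arctan (Z w))"
  have bd: "\<bar>arctan x\<bar> \<le> 2" for x
    using arctan_bounded[of x] pi_less_4 by auto
  have i: "integrable M (\<lambda>w. arctan (Z w))"
    by (rule integrable_const_bound[where B=2]) (auto simp: bd)
  have not_const: "\<not> (AE w in M. arctan (Z w) = \<mu>)"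
  proof
    assume "AE w in M. arctan (Z w) = \<mu>"
    then have "AE w in M. Z w = tan \<mu>"
      by eventually_elim (metis tan_arctan)
    with nonconst show False by blast
  qed
  have not_AE_ge: "\<not> (AE w in M. arctan (Z w) \<ge> \<mu>)"
  proof
    assume *: "AE w in M. arctan (Z w) \<ge> \<mu>"
    have "expectation (\<lambda>w. arctan (Z w) - \<mu>) = 0"
      using i by (simp add: \<mu>_def prob_space)
    then have "AE w in M. arctan (Z w) - \<mu> = 0"
      using * i by (subst (asm) integral_nonneg_eq_0_iff_AE) auto
    with not_const show False by simp
  qed
  have not_AE_le: "\<not> (AE w in M. arctan (Z w) \<le> \<mu>)"
  proof
    assume *: "AE w in M. arctan (Z w) \<le> \<mu>"
    have "expectation (\<lambda>w. \<mu> - arctan (Z w)) = 0"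
      using i by (simp add: \<mu>_def prob_space)
    then have "AE w in M. \<mu> - arctan (Z w) = 0"
      using * i by (subst (asm) integral_nonneg_eq_0_iff_AE) auto
    then have "AE w in M. arctan (Z w) = \<mu>"
      by eventually_elim simp
    with not_const show False by simp
  qed
  obtain w1 where w1: "arctan (Z w1) < \<mu>"
  proof (rule ccontr)
    assume "\<not> thesis"
    then have "\<mu> \<le> arctan (Z w)" for w
      using that[of w] by (meson not_le)
    then show False using not_AE_ge by simp
  qed
  obtain w2 where w2: "\<mu> < arctan (Z w2)"
  proof (rule ccontr)
    assume "\<not> thesis"
    then have "arctan (Z w) \<le> \<mu>" for w
      using that[of w] by (meson not_le)
    then show False using not_AE_le by simp
  qed
  \<comment> \<open>The mean lies strictly between two values of arctan, hence inside (-pi/2, pi/2),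
    where tan inverts arctan.\<close>
  have "arctan (tan \<mu>) = \<mu>"
    using w1 w2 arctan_bounded[of "Z w1"] arctan_bounded[of "Z w2"] by (intro arctan_tan) auto
  then have less: "arctan x < \<mu> \<longleftrightarrow> x < tan \<mu>" "arctan x \<le> \<mu> \<longleftrightarrow> x \<le> tan \<mu>" for x
    using arctan_less_iff[of x "tan \<mu>"] arctan_le_iff[of x "tan \<mu>"] by auto
  have pos: "prob {w \<in> space M. P w} > 0" if "\<not> (AE w in M. \<not> P w)" "Measurable.pred M P" for P
  proof -
    have "{w \<in> space M. P w} \<in> sets M" using that(2) by measurable
    then show ?thesis
      using that(1) prob_eq_0[of "{w \<in> space M. P w}"] by (auto simp: less_le)
  qed
  have "\<not> (AE w in M. \<not> Z w < tan \<mu>)"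
    using not_AE_ge by (simp add: less[symmetric] not_less)
  then have 1: "prob {w \<in> space M. Z w < tan \<mu>} > 0"
    by (rule pos) measurable
  have "\<exists>n. \<not> (AE w in M. \<not> Z w > tan \<mu> + 1 / real (Suc n))"
  proof (rule ccontr)
    assume "\<not> ?thesis"
    then have "AE w in M. \<forall>n. Z w \<le> tan \<mu> + 1 / real (Suc n)"
      by (subst AE_all_countable) (auto simp: not_less)
    then have "AE w in M. Z w \<le> tan \<mu>"
    proof eventually_elim
      case (elim w)
      have "(\<lambda>n. tan \<mu> + 1 / real (Suc n)) \<longlonglongrightarrow> tan \<mu> + 0"
        by (intro tendsto_intros LIMSEQ_Suc[OF lim_const_over_n])
      then show ?case
        using elim by (intro LIMSEQ_le_const[of "\<lambda>n. tan \<mu> + 1 / real (Suc n)"]) auto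
    qed
    then show False using not_AE_le by (simp add: less)
  qed
  then obtain n where "\<not> (AE w in M. \<not> Z w > tan \<mu> + 1 / real (Suc n))" ..
  then have 2: "prob {w \<in> space M. Z w > tan \<mu> + 1 / real (Suc n)} > 0"
    by (rule pos) measurable
  show ?thesis
    by (rule that[OF _ 1 2]) simp
qed

lemma (in prob_space) exists_bounded_event:
  fixes Z :: "'a \<Rightarrow> real"
  assumes [measurable]: "Z \<in> borel_measurable M"
  obtains R where "R \<ge> 1" "prob {w \<in> space M. \<bar>Z w\<bar> \<le> R} > 0"
proof -
  have "(\<lambda>n. prob {w \<in> space M. \<bar>Z w\<bar> \<le> real n}) \<longlonglongrightarrow> prob (\<Union>n. {w \<in> space M. \<bar>Z w\<bar> \<le> real n})"
    by (intro finite_Lim_measure_incseq) (auto simp: incseq_def)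
  also have "(\<Union>n. {w \<in> space M. \<bar>Z w\<bar> \<le> real n}) = space M"
    by (auto intro: real_arch_simple)
  finally have "eventually (\<lambda>n. prob {w \<in> space M. \<bar>Z w\<bar> \<le> real n} > 0) sequentially"
    by (rule order_tendstoD) (simp add: prob_space)
  then have "eventually (\<lambda>n. prob {w \<in> space M. \<bar>Z w\<bar> \<le> real n} > 0 \<and> n \<ge> 1) sequentially"
    using eventually_ge_at_top by (rule eventually_conj)
  then obtain n where "prob {w \<in> space M. \<bar>Z w\<bar> \<le> real n} > 0" "n \<ge> 1"
    by (auto simp: eventually_sequentially)
  then show ?thesis by (intro that[of "real n"]) auto
qed

text \<open>If \<open>\<bar>v\<bar>\<close> is not small, the set of \<open>z\<close> with \<open>\<bar>u + v z\<bar> \<le> \<kappa> y\<close> is an interval too short to reach both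
  \<open>{..<a}\<close> and \<open>{b<..}\<close>; if \<open>\<bar>v\<bar>\<close> is small, \<open>u\<close> dominates on the event that \<open>Z\<close> is bounded by \<open>R\<close>.\<close>

lemma (in prob_space) nonconst_affine_anticoncentration:
  fixes Z :: "'a \<Rightarrow> real"
  assumes [measurable]: "Z \<in> borel_measurable M" and nonconst: "\<not> (\<exists>z. AE w in M. Z w = z)"
  obtains \<delta> \<kappa> where "\<delta> > 0" "\<kappa> > 0"
    "\<And>u v y. y > 0 \<Longrightarrow> y < \<bar>u\<bar> \<or> y < \<bar>v\<bar> \<Longrightarrow> \<delta> \<le> prob {w \<in> space M. \<bar>u + v * Z w\<bar> > \<kappa> * y}"
proof -
  obtain a b where ab: "a < b" "prob {w \<in> space M. Z w < a} > 0" "prob {w \<in> space M. Z w > b} > 0"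
    using nonconst_two_values[OF assms] .
  obtain R where R: "R \<ge> 1" "prob {w \<in> space M. \<bar>Z w\<bar> \<le> R} > 0"
    using exists_bounded_event[OF assms(1)] .
  define \<delta> where "\<delta> = min (prob {w \<in> space M. Z w < a}) (min (prob {w \<in> space M. Z w > b}) (prob {w \<in> space M. \<bar>Z w\<bar> \<le> R}))"
  \<comment> \<open>\<theta> y separates small from large |v|: below it, |v z| \<le> y / 2 whenever
    |z| \<le> R, so |u + v z| > y / 2. Above it, an interval of values z with |u + v z| \<le>
    \<kappa> y has length at most 2 \<kappa> / \<theta>, which the choice of \<kappa> keeps below b
    - a.\<close>
  define \<theta> where "\<theta> = 1 / (2 * R)"
  define \<kappa> where "\<kappa> = min (1 / 4) (\<theta> * (b - a) / 4)"
  have \<theta>: "\<theta> > 0" "\<theta> \<le> 1" "\<theta> * R = 1 / 2"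
    using R by (auto simp: \<theta>_def field_simps)
  have \<kappa>: "\<kappa> > 0" "\<kappa> \<le> 1 / 4" "2 * \<kappa> < \<theta> * (b - a)"
    using ab \<theta> by (auto simp: \<kappa>_def min_def)
  show ?thesis
  proof (rule that[of \<delta> \<kappa>])
    fix u v y :: real
    assume y: "y > 0" and uv: "y < \<bar>u\<bar> \<or> y < \<bar>v\<bar>"
    have sub: "\<delta> \<le> prob {w \<in> space M. \<bar>u + v * Z w\<bar> > \<kappa> * y}"
      if "\<delta> \<le> prob {w \<in> space M. Q (Z w)}" "\<And>z. Q z \<Longrightarrow> \<bar>u + v * z\<bar> > \<kappa> * y" for Q
    proof -
      have "prob {w \<in> space M. Q (Z w)} \<le> prob {w \<in> space M. \<bar>u + v * Z w\<bar> > \<kappa> * y}"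
        by (rule finite_measure_mono) (auto simp: that(2))
      then show ?thesis using that(1) by simp
    qed
    show "\<delta> \<le> prob {w \<in> space M. \<bar>u + v * Z w\<bar> > \<kappa> * y}"
    proof (cases "\<bar>v\<bar> \<ge> \<theta> * y")
      case True
      have "(\<forall>z<a. \<bar>u + v * z\<bar> > \<kappa> * y) \<or> (\<forall>z>b. \<bar>u + v * z\<bar> > \<kappa> * y)"
      proof (rule ccontr)
        assume "\<not> ?thesis"
        then obtain z1 z2 where z: "z1 < a" "\<bar>u + v * z1\<bar> \<le> \<kappa> * y" "z2 > b" "\<bar>u + v * z2\<bar> \<le> \<kappa> * y"
          by (auto simp: not_less)
        have "\<bar>v * (z2 - z1)\<bar> \<le> \<bar>u + v * z2\<bar> + \<bar>u + v * z1\<bar>"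
          by (simp add: right_diff_distrib)
        also have "\<dots> \<le> 2 * \<kappa> * y"
          using z by simp
        also have "\<dots> < \<theta> * (b - a) * y"
          using \<kappa> y by simp
        also have "\<dots> = (\<theta> * y) * (b - a)"
          by simp
        also have "\<dots> \<le> \<bar>v\<bar> * (z2 - z1)"
          using True z ab y \<theta> by (intro mult_mono) auto
        also have "\<dots> = \<bar>v * (z2 - z1)\<bar>"
          using z ab by (simp add: abs_mult)
        finally show False by simp
      qed
      then show ?thesis
        using sub[of "\<lambda>z. z < a"] sub[of "\<lambda>z. z > b"] by (auto simp: \<delta>_def)
    next
      case False
      then have "\<theta> * y \<le> y" "\<bar>v\<bar> < \<theta> * y"
        using \<theta> y by auto
      then have u: "y < \<bar>u\<bar>" using uv by auto
      have "\<bar>u + v * z\<bar> > \<kappa> * y" if "\<bar>z\<bar> \<le> R" for z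
      proof -
        have "\<bar>v * z\<bar> \<le> (\<theta> * y) * R"
          unfolding abs_mult using False that R y \<theta> by (intro mult_mono) auto
        also have "\<dots> = (\<theta> * R) * y"
          by simp
        also have "\<dots> = y / 2"
          unfolding \<theta> by simp
        finally have "\<bar>v * z\<bar> \<le> y / 2" .
        moreover have "\<kappa> * y \<le> 1 / 4 * y"
          using \<kappa> y by (intro mult_right_mono) auto
        ultimately show ?thesis
          using u y by linarith
      qed
      then show ?thesis
        using sub[of "\<lambda>z. \<bar>z\<bar> \<le> R"] by (auto simp: \<delta>_def)
    qed
  qed (use ab R \<kappa> in \<open>auto simp: \<delta>_def\<close>)
qed

section \<open>Necessity: from the tail of Z to the moments of M and Q\<close>

context perpetuity_space
begin

lemma partial_prod_comb_seq:
  "partial_prod (comb_seq n w w') (n + k) = partial_prod w n * partial_prod w' k"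
proof (induction k)
  case (Suc k)
  then show ?case
    using comb_seq_add[of n w w' k] by (simp add: partial_prod_def add.commute)
qed (simp add: partial_prod_def comb_seq_less)

lemma partial_sum_cong:
  assumes "\<And>k. k < n \<Longrightarrow> w k = w' k"
  shows "partial_sum w n = partial_sum w' n" "partial_prod w n = partial_prod w' n"
  using assms by (auto simp: partial_sum_def partial_prod_def summand_def intro!: sum.cong prod.cong arg_cong2[where f="(*)"])

text \<open>Only the future w' has to be regular, since finitely many coordinates do not affect
  convergence. The identity is therefore available for every past w.\<close>

lemma Z_comb_seq:
  assumes "regular_path w'"
  shows "Z (comb_seq n w w') = partial_sum w n + partial_prod w n * Z w'"
proof -
  have s': "summable (summand w')"
    using summable_abs_summand[OF assms] by (rule summable_rabs_cancel)
  have *: "summand (comb_seq n w w') (k + n) = partial_prod w n * summand w' k" for k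
    using partial_prod_comb_seq[of n w w' k] by (simp add: summand_def comb_seq_add add.commute)
  have "summable (\<lambda>k. summand (comb_seq n w w') (k + n))"
    unfolding * by (intro summable_mult s')
  then have "summable (summand (comb_seq n w w'))"
    by (subst (asm) summable_iff_shift)
  then have "Z (comb_seq n w w') = (\<Sum>k. summand (comb_seq n w w') (k + n)) + partial_sum (comb_seq n w w') n"
    unfolding Z_def partial_sum_def by (rule suminf_split_initial_segment)
  also have "(\<Sum>k. summand (comb_seq n w w') (k + n)) = partial_prod w n * Z w'"
    unfolding * Z_def by (intro suminf_mult s')
  also have "partial_sum (comb_seq n w w') n = partial_sum w n"
    by (rule partial_sum_cong) (simp add: comb_seq_less)
  finally show ?thesis by simp
qed

text \<open>The constants of the anticoncentration estimate are uniform in the coefficients, so they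
  serve for all pasts at once, with u the partial sum, v the partial product and Z of an independent
  future as the variable.\<close>

lemma partial_sup_tail:
  assumes nondeg: "\<not> (\<exists>z. AE w in S. Z w = z)"
  obtains \<delta> \<kappa> where "\<delta> > 0" "\<kappa> > 0"
    "\<And>y. y > 0 \<Longrightarrow> ennreal \<delta> * emeasure S {w \<in> space S. \<exists>n. y < \<bar>partial_sum w n\<bar> \<or> y < \<bar>partial_prod w n\<bar>}
       \<le> emeasure S {w \<in> space S. \<bar>Z w\<bar> > \<kappa> * y}"
proof -
  obtain \<delta> \<kappa> where \<delta>: "\<delta> > 0" "\<kappa> > 0" and anti:
    "\<And>u v y. y > 0 \<Longrightarrow> y < \<bar>u\<bar> \<or> y < \<bar>v\<bar> \<Longrightarrow> \<delta> \<le> P.prob {w \<in> space S. \<bar>u + v * Z w\<bar> > \<kappa> * y}"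
    by (rule P.nonconst_affine_anticoncentration[OF measurable_Z nondeg]) blast
  show ?thesis
  proof (rule that[OF \<delta>])
    fix y :: real assume y: "y > 0"
    define E where "E n = {w \<in> space S. y < \<bar>partial_sum w n\<bar> \<or> y < \<bar>partial_prod w n\<bar>}" for n
    define T where "T = {w \<in> space S. \<bar>Z w\<bar> > \<kappa> * y}"
    have [measurable]: "T \<in> sets S" "E n \<in> sets S" for n
      unfolding T_def E_def by measurable
    have "ennreal \<delta> * emeasure S (\<Union>n. E n) \<le> emeasure S T"
    proof (rule emeasure_first_passage)
      fix n w w' assume "w \<in> space S" "w' \<in> space S" "\<And>k. k < n \<Longrightarrow> w k = w' k"
      then show "w \<in> E n \<longleftrightarrow> w' \<in> E n"
        using partial_sum_cong[of n w w'] by (simp add: E_def)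
    next
      fix n w assume w: "w \<in> E n"
      then have ws: "w \<in> space S" by (simp add: E_def)
      have "ennreal \<delta> \<le> emeasure S {w' \<in> space S. \<bar>partial_sum w n + partial_prod w n * Z w'\<bar> > \<kappa> * y}"
        unfolding P.emeasure_eq_measure using w by (intro ennreal_leI anti y) (auto simp: E_def)
      also have "\<dots> = emeasure S {w' \<in> space S. comb_seq n w w' \<in> T}"
      proof (rule emeasure_eq_AE)
        show "AE w' in S. w' \<in> {w' \<in> space S. \<bar>partial_sum w n + partial_prod w n * Z w'\<bar> > \<kappa> * y} \<longleftrightarrow> w' \<in> {w' \<in> space S. comb_seq n w w' \<in> T}"
          using AE_regular_path AE_space
        proof eventually_elim
          case (elim w')
          have "comb_seq n w w' \<in> space S"
            using ws elim by (auto simp: space_PiM PiE_iff comb_seq_def)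
          then show ?case
            using elim by (simp add: T_def Z_comb_seq)
        qed
        show "{w' \<in> space S. comb_seq n w w' \<in> T} \<in> sets S"
          using ws by measurable
      qed measurable
      finally show "ennreal \<delta> \<le> emeasure S {w' \<in> space S. comb_seq n w w' \<in> T}" .
    qed auto
    also have "(\<Union>n. E n) = {w \<in> space S. \<exists>n. y < \<bar>partial_sum w n\<bar> \<or> y < \<bar>partial_prod w n\<bar>}"
      by (auto simp: E_def)
    finally show "ennreal \<delta> * emeasure S {w \<in> space S. \<exists>n. y < \<bar>partial_sum w n\<bar> \<or> y < \<bar>partial_prod w n\<bar>}
       \<le> emeasure S {w \<in> space S. \<bar>Z w\<bar> > \<kappa> * y}"
      by (simp add: T_def)
  qed
qed

lemma AE_all_fst_nonzero: "AE w in S. \<forall>n. fst (w n) \<noteq> 0"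
proof (subst AE_all_countable, rule allI)
  fix n :: nat
  show "AE w in S. fst (w n) \<noteq> 0"
    using AE_PiM_component[of UNIV "\<lambda>_. N" n "\<lambda>s. fst s \<noteq> 0"] AE_fst_nonzero M.prob_space_axioms
    by simp
qed

definition log_size :: "real \<times> real \<Rightarrow> real" where
  "log_size s = max (log_plus \<bar>fst s\<bar>) (log_plus \<bar>snd s\<bar>)"

text \<open>Multiplying |Pi_n| by the exponential of \<open>log_size\<close> gives |Pi_(n+1)| or a
  summand of the series. A summand is the difference of two consecutive partial sums, so one of
  these exceeds half of it. Positivity of \<open>log_size\<close> ensures that log+ is not cut off
  at 0.\<close>

lemma partial_exceeds:
  assumes nz: "\<And>n. fst (w n) \<noteq> 0" and pos: "log_size (w n) > 0"
    and ex: "walk (\<lambda>s. ln \<bar>fst s\<bar>) w n + log_size (w n) > x"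
  shows "\<exists>n. exp x / 2 < \<bar>partial_sum w n\<bar> \<or> exp x / 2 < \<bar>partial_prod w n\<bar>"
proof -
  have pp: "\<bar>partial_prod w n\<bar> = exp (walk (\<lambda>s. ln \<bar>fst s\<bar>) w n)"
    using nz by (simp add: partial_prod_def abs_prod walk_def exp_sum)
  have e: "exp (log_plus t) = t" if "log_plus t > 0" for t
    using that by (auto simp: log_plus_def max_def split: if_splits)
  have "exp (log_size (w n)) = \<bar>fst (w n)\<bar> \<or> exp (log_size (w n)) = \<bar>snd (w n)\<bar>"
    using pos e by (auto simp: log_size_def max_def split: if_splits)
  moreover have gt: "exp x < \<bar>partial_prod w n\<bar> * exp (log_size (w n))"
    using ex by (simp add: pp exp_add[symmetric])
  ultimately consider "exp x < \<bar>partial_prod w n * fst (w n)\<bar>" | "exp x < \<bar>partial_prod w n * snd (w n)\<bar>"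
    by (auto simp: abs_mult)
  then show ?thesis
  proof cases
    case 1
    then have "exp x / 2 < \<bar>partial_prod w (Suc n)\<bar>"
      using exp_gt_zero[of x] by (simp add: partial_prod_def)
    then show ?thesis by blast
  next
    case 2
    then have "exp x < \<bar>partial_sum w (Suc n) - partial_sum w n\<bar>"
      by (simp add: partial_sum_def summand_def)
    then have "exp x / 2 < \<bar>partial_sum w (Suc n)\<bar> \<or> exp x / 2 < \<bar>partial_sum w n\<bar>"
      by linarith
    then show ?thesis by blast
  qed
qed

lemma log_size_moment:
  assumes B: "moderate_growth B p" and nondeg: "\<not> (\<exists>z. AE w in S. Z w = z)"
    and fin: "(\<integral>\<^sup>+w. ennreal (B (log_plus \<bar>Z w\<bar>)) \<partial>S) < \<infinity>"
  shows "(\<integral>\<^sup>+s. ennreal (log_size s * B (log_size s)) \<partial>N) < \<infinity>"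
proof -
  have i1: "integrable N (\<lambda>s. log_plus \<bar>fst s\<bar>)"
    unfolding log_plus_abs_eq using integrable_ln_fst by auto
  have isz: "integrable N log_size"
    unfolding log_size_def[abs_def] using i1 integrable_log_plus_snd by auto
  then have [measurable]: "log_size \<in> borel_measurable N"
    by auto
  have nn: "log_size s \<ge> 0" for s
    by (simp add: log_size_def le_max_iff_disj)
  obtain \<delta> \<kappa> where \<delta>: "\<delta> > 0" "\<kappa> > 0" and tail:
    "\<And>y. y > 0 \<Longrightarrow> ennreal \<delta> * emeasure S {w \<in> space S. \<exists>n. y < \<bar>partial_sum w n\<bar> \<or> y < \<bar>partial_prod w n\<bar>}
       \<le> emeasure S {w \<in> space S. \<bar>Z w\<bar> > \<kappa> * y}"
    by (rule partial_sup_tail[OF nondeg]) blast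
  obtain A x0 where A: "A > 0" "x0 \<ge> 0" and exc:
    "\<And>x. x \<ge> x0 \<Longrightarrow> ennreal (1 / 4) * (\<integral>\<^sup>+s. ennreal (max 0 ((log_size s - x) / A)) \<partial>N)
       \<le> emeasure S {w \<in> space S. \<exists>n. log_size (w n) > 0 \<and> walk (\<lambda>s. ln \<bar>fst s\<bar>) w n + log_size (w n) > x}"
    by (rule perturbed_walk_exceeds[OF integrable_ln_fst isz nn]) blast
  \<comment> \<open>The shift c turns the threshold \<kappa> exp x / 2 for |Z| into exp (x - c).
    Requiring x \<ge> c below makes the new level nonnegative, where log+ can be compared with
    it.\<close>
  define c where "c = max 0 (- ln (\<kappa> / 2))"
  have "(\<integral>\<^sup>+s. ennreal (max 0 ((log_size s - x) / A)) \<partial>N) \<le> ennreal (4 / \<delta>) * emeasure S {w \<in> space S. log_plus \<bar>Z w\<bar> > x - c}"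
    if x: "x \<ge> max x0 c" for x
  proof -
    have "ennreal (1 / 4) * (\<integral>\<^sup>+s. ennreal (max 0 ((log_size s - x) / A)) \<partial>N)
      \<le> emeasure S {w \<in> space S. \<exists>n. log_size (w n) > 0 \<and> walk (\<lambda>s. ln \<bar>fst s\<bar>) w n + log_size (w n) > x}"
      using x by (intro exc) simp
    also have "\<dots> \<le> emeasure S {w \<in> space S. \<exists>n. exp x / 2 < \<bar>partial_sum w n\<bar> \<or> exp x / 2 < \<bar>partial_prod w n\<bar>}"
    proof (rule emeasure_mono_AE)
      show "AE w in S. w \<in> {w \<in> space S. \<exists>n. log_size (w n) > 0 \<and> walk (\<lambda>s. ln \<bar>fst s\<bar>) w n + log_size (w n) > x} \<longrightarrow>
        w \<in> {w \<in> space S. \<exists>n. exp x / 2 < \<bar>partial_sum w n\<bar> \<or> exp x / 2 < \<bar>partial_prod w n\<bar>}"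
        using AE_all_fst_nonzero by eventually_elim (use partial_exceeds in blast)
    qed measurable
    finally have "ennreal \<delta> * (ennreal (1 / 4) * (\<integral>\<^sup>+s. ennreal (max 0 ((log_size s - x) / A)) \<partial>N))
      \<le> ennreal \<delta> * emeasure S {w \<in> space S. \<exists>n. exp x / 2 < \<bar>partial_sum w n\<bar> \<or> exp x / 2 < \<bar>partial_prod w n\<bar>}"
      by (rule mult_left_mono) simp
    also have "\<dots> \<le> emeasure S {w \<in> space S. \<bar>Z w\<bar> > \<kappa> * (exp x / 2)}"
      by (rule tail) simp
    also have "\<dots> \<le> emeasure S {w \<in> space S. log_plus \<bar>Z w\<bar> > x - c}"
    proof (rule emeasure_mono)
      show "{w \<in> space S. \<bar>Z w\<bar> > \<kappa> * (exp x / 2)} \<subseteq> {w \<in> space S. log_plus \<bar>Z w\<bar> > x - c}"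
      proof clarify
        fix w assume w: "\<kappa> * (exp x / 2) < \<bar>Z w\<bar>"
        have "exp (x - c) \<le> exp (x + ln (\<kappa> / 2))"
          by (simp add: c_def)
        also have "\<dots> = \<kappa> * (exp x / 2)"
          using \<delta> by (simp add: exp_add)
        also note w
        finally show "log_plus \<bar>Z w\<bar> > x - c"
          using log_plus_le_iff[of "x - c" "\<bar>Z w\<bar>"] x by simp
      qed
    qed measurable
    finally have "ennreal (4 / \<delta>) * (ennreal \<delta> * (ennreal (1 / 4) * (\<integral>\<^sup>+s. ennreal (max 0 ((log_size s - x) / A)) \<partial>N)))
      \<le> ennreal (4 / \<delta>) * emeasure S {w \<in> space S. log_plus \<bar>Z w\<bar> > x - c}"
      by (rule mult_left_mono) simp
    \<comment> \<open>The factor 4 / \<delta> undoes both losses: 1/4 from the perturbed walk and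
      \<delta> from the anticoncentration of Z.\<close>
    moreover have "ennreal (4 / \<delta>) * (ennreal \<delta> * ennreal (1 / 4)) = 1"
      using \<delta> by (simp add: ennreal_mult'[symmetric])
    ultimately show ?thesis
      by (simp add: mult.assoc[symmetric])
  qed
  moreover have "(\<integral>\<^sup>+s. ennreal (log_size s) \<partial>N) < \<infinity>"
    using isz nn by (subst nn_integral_eq_integral) auto
  ultimately show ?thesis
    using fin A nn
    by (intro moderate_growth.tail_sum_moment[OF B, where Y="\<lambda>w. log_plus \<bar>Z w\<bar>" and c=c and ?x0.0="max x0 c" and ?M2.0=S])
      (auto simp: c_def intro: P.prob_space_axioms)
qed

end

subsection \<open>Transfer to an arbitrary probability space\<close>

lemma nn_integral_affine_bound_finite:
  fixes f g h :: "'a \<Rightarrow> real"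
  assumes [measurable]: "f \<in> borel_measurable N" "h \<in> borel_measurable N"
    and a: "a \<ge> 0" and nn: "\<And>x. f x \<ge> 0" "\<And>x. h x \<ge> 0"
    and le: "\<And>x. g x \<le> a * f x + h x"
    and fin: "(\<integral>\<^sup>+x. ennreal (f x) \<partial>N) < \<infinity>" "(\<integral>\<^sup>+x. ennreal (h x) \<partial>N) < \<infinity>"
  shows "(\<integral>\<^sup>+x. ennreal (g x) \<partial>N) < \<infinity>"
proof -
  have "(\<integral>\<^sup>+x. ennreal (g x) \<partial>N) \<le> (\<integral>\<^sup>+x. ennreal a * ennreal (f x) + ennreal (h x) \<partial>N)"
    using le a nn by (intro nn_integral_mono) (simp add: ennreal_mult'[symmetric] ennreal_plus[symmetric] ennreal_leI del: ennreal_plus)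
  also have "\<dots> = ennreal a * (\<integral>\<^sup>+x. ennreal (f x) \<partial>N) + (\<integral>\<^sup>+x. ennreal (h x) \<partial>N)"
    by (simp add: nn_integral_add nn_integral_cmult)
  also have "\<dots> < \<infinity>"
    using fin by (auto simp: ennreal_mult_less_top)
  finally show ?thesis .
qed

text \<open>Independence and equal laws make the joint law on the index set {1..} a product measure;
  reindexing by \<open>Suc\<close> turns it into the product over all natural numbers, discarding
  the entry at 0.\<close>

lemma (in prob_space) distr_sequence_eq_PiM:
  assumes indep: "indep_vars (\<lambda>_. borel) (X :: nat \<Rightarrow> 'a \<Rightarrow> 'b::topological_space) {1..}"
    and copies: "\<And>k. k \<ge> 1 \<Longrightarrow> distr M borel (X k) = N"
  shows "(\<lambda>\<omega> k. X (Suc k) \<omega>) \<in> M \<rightarrow>\<^sub>M (\<Pi>\<^sub>M i\<in>UNIV. N)"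
    "distr M (\<Pi>\<^sub>M i\<in>UNIV. N) (\<lambda>\<omega> k. X (Suc k) \<omega>) = (\<Pi>\<^sub>M i\<in>UNIV. N)"
proof -
  let ?I = "{1..} :: nat set"
  have rv: "random_variable borel (X k)" if "k \<in> ?I" for k
    using indep that unfolding indep_vars_def by auto
  have N: "sets N = sets borel"
    unfolding copies[of 1, OF order_refl, symmetric] by simp
  have prob_N: "prob_space N"
    using prob_space_distr[OF rv[of 1]] copies[of 1] by simp
  have XN: "(\<lambda>\<omega>. \<lambda>k\<in>?I. X k \<omega>) \<in> M \<rightarrow>\<^sub>M (\<Pi>\<^sub>M i\<in>?I. N)"
    using rv by (intro measurable_restrict) (simp add: measurable_cong_sets[OF refl N])
  have reidx: "(\<lambda>w. \<lambda>n\<in>UNIV. w (Suc n)) \<in> (\<Pi>\<^sub>M i\<in>?I. N) \<rightarrow>\<^sub>M (\<Pi>\<^sub>M i\<in>UNIV. N)"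
    by (intro measurable_restrict measurable_component_singleton) auto
  have comp: "(\<lambda>w. \<lambda>n\<in>UNIV. w (Suc n)) \<circ> (\<lambda>\<omega>. \<lambda>k\<in>?I. X k \<omega>) = (\<lambda>\<omega> n. X (Suc n) \<omega>)"
    by (auto simp: fun_eq_iff)
  show "(\<lambda>\<omega> k. X (Suc k) \<omega>) \<in> M \<rightarrow>\<^sub>M (\<Pi>\<^sub>M i\<in>UNIV. N)"
    using measurable_comp[OF XN reidx] unfolding comp .
  have "distr M (\<Pi>\<^sub>M i\<in>?I. N) (\<lambda>\<omega>. \<lambda>k\<in>?I. X k \<omega>) = distr M (\<Pi>\<^sub>M i\<in>?I. borel) (\<lambda>\<omega>. \<lambda>k\<in>?I. X k \<omega>)"
    by (intro distr_cong sets_PiM_cong) (simp_all add: N)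
  also have "\<dots> = (\<Pi>\<^sub>M k\<in>?I. distr M borel (X k))"
    using indep by (subst (asm) indep_vars_iff_distr_eq_PiM') (use rv in auto)
  also have "\<dots> = (\<Pi>\<^sub>M k\<in>?I. N)"
    by (intro PiM_cong) (auto simp: copies)
  finally have "distr (distr M (\<Pi>\<^sub>M i\<in>?I. N) (\<lambda>\<omega>. \<lambda>k\<in>?I. X k \<omega>)) (\<Pi>\<^sub>M i\<in>UNIV. N) (\<lambda>w. \<lambda>n\<in>UNIV. w (Suc n)) = (\<Pi>\<^sub>M i\<in>UNIV. N)"
    using distr_PiM_reindex[of ?I "\<lambda>_. N" Suc UNIV] prob_N by simp
  then show "distr M (\<Pi>\<^sub>M i\<in>UNIV. N) (\<lambda>\<omega> k. X (Suc k) \<omega>) = (\<Pi>\<^sub>M i\<in>UNIV. N)"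
    by (simp only: distr_distr[OF reidx XN] comp)
qed

theorem theorem2p1:
  fixes P :: "'a measure"
    and M Q :: "'a \<Rightarrow> real"
    and Ms Qs :: "nat \<Rightarrow> 'a \<Rightarrow> real"
    and b c :: "real \<Rightarrow> real"
    and \<beta> :: real
  assumes prob: "prob_space P"
    and meas: "M \<in> borel_measurable P" "Q \<in> borel_measurable P"
    and indep: "prob_space.indep_vars P (\<lambda>_. borel) (\<lambda>k \<omega>. (Ms k \<omega>, Qs k \<omega>)) {1..}"
    and copies: "\<And>k. k \<ge> 1 \<Longrightarrow>
          distr P borel (\<lambda>\<omega>. (Ms k \<omega>, Qs k \<omega>)) = distr P borel (\<lambda>\<omega>. (M \<omega>, Q \<omega>))"
    and M_nonzero: "measure P {\<omega> \<in> space P. M \<omega> = 0} = 0"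
    and Q_nonzero: "measure P {\<omega> \<in> space P. Q \<omega> = 0} < 1"
    and nondegenerate: "(AE \<omega> in P. perpetuity_abs_conv Ms Qs \<omega>) \<Longrightarrow>
          \<not> (\<exists>z. AE \<omega> in P. perpetuity Ms Qs \<omega> = z)"
    and b_nonneg: "\<And>x. x \<ge> 0 \<Longrightarrow> b x \<ge> 0"
    and b_locally_bounded: "\<And>a. bounded (b ` {0..a})"
    and b_regularly_varying: "regularly_varying_at_top b \<beta>"
    and beta_pos: "\<beta> > 0"
    and c_eq: "c = (\<lambda>x. x * b x)"
    and log_M: "integrable P (\<lambda>\<omega>. ln \<bar>M \<omega>\<bar>)" "(\<integral>\<omega>. ln \<bar>M \<omega>\<bar> \<partial>P) < 0"
    and log_Q: "(\<integral>\<^sup>+\<omega>. ennreal (log_plus \<bar>Q \<omega>\<bar>) \<partial>P) < \<infinity>"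
  shows "(\<integral>\<^sup>+\<omega>. ennreal (b (log_plus \<bar>perpetuity Ms Qs \<omega>\<bar>)) \<partial>P) < \<infinity> \<longleftrightarrow>
         (\<integral>\<^sup>+\<omega>. ennreal (c (log_plus \<bar>M \<omega>\<bar>)) \<partial>P) < \<infinity> \<and>
         (\<integral>\<^sup>+\<omega>. ennreal (c (log_plus \<bar>Q \<omega>\<bar>)) \<partial>P) < \<infinity>"
proof -
  interpret P: prob_space P by fact
  note [measurable] = meas
  define N where "N = distr P borel (\<lambda>\<omega>. (M \<omega>, Q \<omega>))"
  have MQ [measurable]: "(\<lambda>\<omega>. (M \<omega>, Q \<omega>)) \<in> P \<rightarrow>\<^sub>M borel"
    unfolding borel_prod[symmetric] by measurable
  have fst_snd [measurable]: "fst \<in> borel_measurable (borel :: (real \<times> real) measure)"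
      "snd \<in> borel_measurable (borel :: (real \<times> real) measure)"
    unfolding borel_prod[symmetric] by measurable
  interpret N: prob_space N
    unfolding N_def by (rule P.prob_space_distr) measurable
  have ln_int: "integrable N (\<lambda>s. ln \<bar>fst s\<bar>)" "(\<integral>s. ln \<bar>fst s\<bar> \<partial>N) = (\<integral>\<omega>. ln \<bar>M \<omega>\<bar> \<partial>P)"
    unfolding N_def using log_M by (simp_all add: integrable_distr_eq integral_distr)
  have lpQ: "integrable P (\<lambda>\<omega>. log_plus \<bar>Q \<omega>\<bar>)"
    using log_Q by (intro integrableI_nonneg) auto
  interpret pair: product_prob_space "\<lambda>_. N" "UNIV :: nat set"
    by (intro product_prob_spaceI N.prob_space_axioms)
  interpret Z: perpetuity_space N
  proof unfold_locales
    show "sets N = sets borel"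
      by (simp add: N_def)
    have "AE \<omega> in P. M \<omega> \<noteq> 0"
      using M_nonzero P.prob_eq_0[of "{\<omega> \<in> space P. M \<omega> = 0}"] by auto
    then show "AE s in N. fst s \<noteq> 0"
      unfolding N_def by (subst AE_distr_iff) auto
    show "integrable N (\<lambda>s. ln \<bar>fst s\<bar>)" "(\<integral>s. ln \<bar>fst s\<bar> \<partial>N) < 0"
      using ln_int log_M by simp_all
    show "integrable N (\<lambda>s. log_plus \<bar>snd s\<bar>)"
      unfolding N_def using lpQ by (simp add: integrable_distr_eq)
  qed
  define W where "W \<omega> k = (Ms (Suc k) \<omega>, Qs (Suc k) \<omega>)" for \<omega> k
  have copies': "k \<ge> 1 \<Longrightarrow> distr P borel (\<lambda>\<omega>. (Ms k \<omega>, Qs k \<omega>)) = N" for k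
    unfolding N_def by (rule copies)
  have W [measurable]: "W \<in> P \<rightarrow>\<^sub>M Z.S" and distr_W: "distr P Z.S W = Z.S"
    using P.distr_sequence_eq_PiM[OF indep copies'] unfolding W_def[abs_def] by auto
  have disc: "discount Ms k \<omega> = Z.partial_prod (W \<omega>) k" for k \<omega>
    by (simp add: discount_def Z.partial_prod_def W_def prod.atLeast1_atMost_eq)
  have Z_W: "perpetuity Ms Qs \<omega> = Z.Z (W \<omega>)" for \<omega>
    by (simp add: perpetuity_def Z.Z_def Z.summand_def disc W_def)
  have AE_W: "AE \<omega> in P. R (W \<omega>)" if "AE w in Z.S. R w" for R
    by (rule AE_distrD[OF W]) (subst distr_W, rule that)
  have "AE \<omega> in P. perpetuity_abs_conv Ms Qs \<omega>"
    using AE_W[OF Z.AE_regular_path]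
  proof eventually_elim
    case (elim \<omega>)
    then show ?case
      using Z.summable_abs_summand[of "W \<omega>"] by (simp add: perpetuity_abs_conv_def Z.summand_def disc W_def)
  qed
  \<comment> \<open>Absolute convergence discharges the premise of \<open>nondegenerate\<close>; a
    constant value of Z on the sequence space would pull back along \<open>W\<close> to a constant
    perpetuity.\<close>
  then have nondeg: "\<not> (\<exists>z. AE w in Z.S. Z.Z w = z)"
    using nondegenerate AE_W unfolding Z_W by blast
  obtain B p C where B: "moderate_growth B p" and C: "C \<ge> 0"
    and Bb: "\<And>x. x \<ge> 0 \<Longrightarrow> B x \<le> b x + C" and bB: "\<And>x. x \<ge> 0 \<Longrightarrow> b x \<le> C * B x"
    using regularly_varying_moderate_growth[OF b_regularly_varying b_nonneg beta_pos b_locally_bounded] by metis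
  interpret B: moderate_growth B p by fact
  note [measurable] = B.measurable_B
  have b_meas: "(\<lambda>\<omega>. b (Y \<omega>)) \<in> borel_measurable P"
    if [measurable]: "Y \<in> borel_measurable P" and "\<And>\<omega>. Y \<omega> \<ge> 0" for Y
  proof -
    have Y: "Y \<in> P \<rightarrow>\<^sub>M restrict_space borel {0..}"
      using that by (intro measurable_restrict_space2) auto
    have "b \<in> borel_measurable (restrict_space borel {0..})"
      using b_regularly_varying by (simp add: regularly_varying_at_top_def)
    from measurable_compose[OF Y this] show ?thesis .
  qed
  \<comment> \<open>The additive constant in the comparison of B with b is harmless because the
    total mass is finite.\<close>
  have b_iff: "(\<integral>\<^sup>+\<omega>. ennreal (b (Y \<omega>)) \<partial>P) < \<infinity> \<longleftrightarrow> (\<integral>\<^sup>+\<omega>. ennreal (B (Y \<omega>)) \<partial>P) < \<infinity>"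
    if Y [measurable]: "Y \<in> borel_measurable P" and nn: "\<And>\<omega>. Y \<omega> \<ge> 0" for Y
  proof
    assume "(\<integral>\<^sup>+\<omega>. ennreal (b (Y \<omega>)) \<partial>P) < \<infinity>"
    then show "(\<integral>\<^sup>+\<omega>. ennreal (B (Y \<omega>)) \<partial>P) < \<infinity>"
      by (rule nn_integral_affine_bound_finite[where h="\<lambda>_. C" and a=1, rotated 6])
        (use b_meas[OF Y nn] nn C Bb b_nonneg in \<open>auto simp: P.emeasure_space_1\<close>)
  next
    assume "(\<integral>\<^sup>+\<omega>. ennreal (B (Y \<omega>)) \<partial>P) < \<infinity>"
    then show "(\<integral>\<^sup>+\<omega>. ennreal (b (Y \<omega>)) \<partial>P) < \<infinity>"
      by (rule nn_integral_affine_bound_finite[where h="\<lambda>_. 0" and a=C, rotated 6]) (use nn C bB in auto)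
  qed
  \<comment> \<open>After multiplication by Y the additive constant becomes C Y. This is why Y is
    taken integrable, as log+ |M| and log+ |Q| are.\<close>
  have c_iff: "(\<integral>\<^sup>+\<omega>. ennreal (c (Y \<omega>)) \<partial>P) < \<infinity> \<longleftrightarrow> (\<integral>\<^sup>+\<omega>. ennreal (Y \<omega> * B (Y \<omega>)) \<partial>P) < \<infinity>"
    if Yi: "integrable P Y" and nn: "\<And>\<omega>. Y \<omega> \<ge> 0" for Y
  proof
    have Y [measurable]: "Y \<in> borel_measurable P"
      using Yi by auto
    have [measurable]: "(\<lambda>\<omega>. c (Y \<omega>)) \<in> borel_measurable P"
      unfolding c_eq using b_meas[OF Y nn] by measurable
    have fin: "(\<integral>\<^sup>+\<omega>. ennreal (C * Y \<omega>) \<partial>P) < \<infinity>"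
      using Yi nn C by (subst nn_integral_eq_integral) auto
    have c_nonneg: "c (Y \<omega>) \<ge> 0" for \<omega>
      using nn b_nonneg by (simp add: c_eq)
    have le: "Y \<omega> * B (Y \<omega>) \<le> 1 * c (Y \<omega>) + C * Y \<omega>" for \<omega>
      using mult_left_mono[OF Bb[OF nn] nn, of \<omega> \<omega>] by (simp add: c_eq algebra_simps)
    assume "(\<integral>\<^sup>+\<omega>. ennreal (c (Y \<omega>)) \<partial>P) < \<infinity>"
    then show "(\<integral>\<^sup>+\<omega>. ennreal (Y \<omega> * B (Y \<omega>)) \<partial>P) < \<infinity>"
      by (rule nn_integral_affine_bound_finite[OF _ _ _ _ _ le _ fin, rotated 5])
        (use nn C c_nonneg in auto)
  next
    have Y [measurable]: "Y \<in> borel_measurable P"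
      using Yi by auto
    have le: "c (Y \<omega>) \<le> C * (Y \<omega> * B (Y \<omega>)) + 0" for \<omega>
      using mult_left_mono[OF bB[OF nn] nn, of \<omega> \<omega>] by (simp add: c_eq algebra_simps)
    assume "(\<integral>\<^sup>+\<omega>. ennreal (Y \<omega> * B (Y \<omega>)) \<partial>P) < \<infinity>"
    then show "(\<integral>\<^sup>+\<omega>. ennreal (c (Y \<omega>)) \<partial>P) < \<infinity>"
      by (rule nn_integral_affine_bound_finite[OF _ _ _ _ _ le, rotated 5])
        (use nn C in auto)
  qed
  have lpM: "integrable P (\<lambda>\<omega>. log_plus \<bar>M \<omega>\<bar>)"
    unfolding log_plus_abs_eq using log_M by auto
  have eq_fst: "(\<integral>\<^sup>+s. ennreal (log_plus \<bar>fst s\<bar> * B (log_plus \<bar>fst s\<bar>)) \<partial>N) = (\<integral>\<^sup>+\<omega>. ennreal (log_plus \<bar>M \<omega>\<bar> * B (log_plus \<bar>M \<omega>\<bar>)) \<partial>P)"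
    unfolding N_def by (subst nn_integral_distr) auto
  have eq_snd: "(\<integral>\<^sup>+s. ennreal (log_plus \<bar>snd s\<bar> * B (log_plus \<bar>snd s\<bar>)) \<partial>N) = (\<integral>\<^sup>+\<omega>. ennreal (log_plus \<bar>Q \<omega>\<bar> * B (log_plus \<bar>Q \<omega>\<bar>)) \<partial>P)"
    unfolding N_def by (subst nn_integral_distr) auto
  have "(\<integral>\<^sup>+w. ennreal (B (log_plus \<bar>Z.Z w\<bar>)) \<partial>distr P Z.S W) = (\<integral>\<^sup>+\<omega>. ennreal (B (log_plus \<bar>perpetuity Ms Qs \<omega>\<bar>)) \<partial>P)"
    unfolding Z_W by (rule nn_integral_distr) measurable
  then have eq_Z: "(\<integral>\<^sup>+w. ennreal (B (log_plus \<bar>Z.Z w\<bar>)) \<partial>Z.S) = (\<integral>\<^sup>+\<omega>. ennreal (B (log_plus \<bar>perpetuity Ms Qs \<omega>\<bar>)) \<partial>P)"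
    by (simp only: distr_W)
  have [measurable]: "(\<lambda>\<omega>. perpetuity Ms Qs \<omega>) \<in> borel_measurable P"
    unfolding Z_W by measurable
  have log_size_bounds: "(\<integral>\<^sup>+s. ennreal (log_plus \<bar>g s\<bar> * B (log_plus \<bar>g s\<bar>)) \<partial>N) \<le> (\<integral>\<^sup>+s. ennreal (Z.log_size s * B (Z.log_size s)) \<partial>N)"
    if "\<And>s. log_plus \<bar>g s\<bar> \<le> Z.log_size s" for g
    using that by (intro nn_integral_mono ennreal_leI B.times_B_mono) auto
  have "(\<integral>\<^sup>+w. ennreal (B (log_plus \<bar>Z.Z w\<bar>)) \<partial>Z.S) < \<infinity> \<longleftrightarrow>
    (\<integral>\<^sup>+s. ennreal (log_plus \<bar>fst s\<bar> * B (log_plus \<bar>fst s\<bar>)) \<partial>N) < \<infinity> \<and>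
    (\<integral>\<^sup>+s. ennreal (log_plus \<bar>snd s\<bar> * B (log_plus \<bar>snd s\<bar>)) \<partial>N) < \<infinity>"
  proof
    assume "(\<integral>\<^sup>+w. ennreal (B (log_plus \<bar>Z.Z w\<bar>)) \<partial>Z.S) < \<infinity>"
    then have "(\<integral>\<^sup>+s. ennreal (Z.log_size s * B (Z.log_size s)) \<partial>N) < \<infinity>"
      by (rule Z.log_size_moment[OF B nondeg])
    then show "(\<integral>\<^sup>+s. ennreal (log_plus \<bar>fst s\<bar> * B (log_plus \<bar>fst s\<bar>)) \<partial>N) < \<infinity> \<and>
      (\<integral>\<^sup>+s. ennreal (log_plus \<bar>snd s\<bar> * B (log_plus \<bar>snd s\<bar>)) \<partial>N) < \<infinity>"
      using log_size_bounds[of fst] log_size_bounds[of snd]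
      by (auto simp: Z.log_size_def intro: order.strict_trans1)
  next
    assume "(\<integral>\<^sup>+s. ennreal (log_plus \<bar>fst s\<bar> * B (log_plus \<bar>fst s\<bar>)) \<partial>N) < \<infinity> \<and>
      (\<integral>\<^sup>+s. ennreal (log_plus \<bar>snd s\<bar> * B (log_plus \<bar>snd s\<bar>)) \<partial>N) < \<infinity>"
    then show "(\<integral>\<^sup>+w. ennreal (B (log_plus \<bar>Z.Z w\<bar>)) \<partial>Z.S) < \<infinity>"
      using Z.perpetuity_moment[OF B] by blast
  qed
  moreover note b_iff[of "\<lambda>\<omega>. log_plus \<bar>perpetuity Ms Qs \<omega>\<bar>"] c_iff[OF lpM] c_iff[OF lpQ]
  ultimately show ?thesis
    unfolding eq_Z eq_fst eq_snd by simp
qed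

end
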